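(* The measure of acyclicity is an energy functional for knots. That is, for any real numbers $b$ and $\delta$ with $0<\delta\le\frac12$ there exists a positive constant $C=C(b,\delta)$ such that: if a knot $K\subset\mathbb{R}^3$ with length $l(K)$ contains a pair of points $x,y$ such that the shorter arc-length along $K$ between them is equal to $\delta\, l(K)$ and $|x-y|\le C\,l(K)$, then $\mathrm{mnts}(K)\ge b$.
   Context: A knot $K$ is the image of an embedding $f:S^1\to\mathbb{R}^3$ of class $C^2$. Spheres include planes. $\Lambda$ denotes the set of oriented 2-spheres in $S^3=\mathbb{R}^3\cup\{\infty\}$. It is identified with $\{x\in\mathbb{R}^5: L(x,x)=1\}$, $L$ the Lorentz form of signature $(4,1)$, and carries a measure $d\Sigma$ invariant under the conformal group; in terms of the Euclidean center $(X,Y,Z)$ and radius $r$ of a sphere it is $d\Sigma=\frac{1}{r^4}|dX\wedge dY\wedge dZ\wedge dr|$. An oriented 2-sphere $\Sigma$ with $\Sigma=\partial D^3$ ($D^3$ being the side determined by the orientation) is a non-trivial sphere in the strict sense for $K$ if $\mathrm{Int}\,D^3\cap K$ contains at least 2 connected components of $K\setminus\Sigma$. $NT(K)\subset\Lambda$ is the set of these spheres. The measure of acyclicity is $$\mathrm{mnts}(K)=\int_{NT(K)}\binom{n_K(\Sigma)}{2}\,d\Sigma,\qquad n_K(\Sigma)=\frac{\sharp(\Sigma\cap K)}{2},$$ where the number $\sharp(\Sigma\cap K)$ of intersection points is counted with multiplicity. *)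

theory Defs
  imports "HOL-Analysis.Analysis" "HOL-Library.Landau_Symbols"
begin

section \<open>Knots of class \<open>C\<^sup>2\<close>\<close>

text \<open>
  The circle is the unit circle of the complex plane, with angle coordinate \<open>cis\<close>.
  An embedding of class \<open>C\<^sup>2\<close> is in particular an immersion.
\<close>

definition C2_embedding :: "(complex \<Rightarrow> real^3) \<Rightarrow> bool" where
  "C2_embedding f \<longleftrightarrow>
     inj_on f (sphere 0 1) \<and>
     (\<exists>f' f''. (\<forall>t. ((\<lambda>t. f (cis t)) has_vector_derivative f' t) (at t)) \<and>
               (\<forall>t. (f' has_vector_derivative f'' t) (at t)) \<and>
               continuous_on UNIV f'' \<and>
               (\<forall>t. f' t \<noteq> 0))"

definition arc_length :: "(complex \<Rightarrow> real^3) \<Rightarrow> real \<Rightarrow> real \<Rightarrow> real" where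
  "arc_length f s t = integral {s..t} (\<lambda>u. norm (vector_derivative (\<lambda>u. f (cis u)) (at u)))"

definition knot_length :: "(complex \<Rightarrow> real^3) \<Rightarrow> real" where
  "knot_length f = arc_length f 0 (2 * pi)"

text \<open>
  The shorter of the two arcs of the knot between \<open>f (cis s)\<close> and \<open>f (cis t)\<close>;
  meant for \<open>0 \<le> s \<le> t \<le> 2 * pi\<close>.
\<close>

definition shorter_arc_length :: "(complex \<Rightarrow> real^3) \<Rightarrow> real \<Rightarrow> real \<Rightarrow> real" where
  "shorter_arc_length f s t = min (arc_length f s t) (knot_length f - arc_length f s t)"


section \<open>The space of oriented spheres\<close>

type_synonym minkowski = "(real^3) \<times> real \<times> real"

definition lorentz :: "minkowski \<Rightarrow> minkowski \<Rightarrow> real" where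
  "lorentz x y = (case x of (u, a, b) \<Rightarrow> case y of (v, c, d) \<Rightarrow> u \<bullet> v + a * c - b * d)"

definition Lambda :: "minkowski set" where
  "Lambda = {x. lorentz x x = 1}"

text \<open>
  A point of \<open>\<real>\<^sup>3\<close> is represented by a vector of the light cone; it corresponds to a point of
  \<open>S\<^sup>3\<close> by (inverse) stereographic projection, after rescaling the last coordinate to 1. (The
  point at infinity is the light ray of \<open>(0, 1, 1)\<close>; it never lies on a knot, so it is not needed.)
\<close>

definition light_point :: "real^3 \<Rightarrow> minkowski" where
  "light_point p = (p, ((norm p)\<^sup>2 - 1) / 2, ((norm p)\<^sup>2 + 1) / 2)"

text \<open>
  An element \<open>\<sigma>\<close> of \<open>Lambda\<close> is the oriented sphere cut out of \<open>S\<^sup>3\<close> by the Lorentz-orthogonal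
  hyperplane of \<open>\<sigma>\<close>. It bounds the side \<open>D\<^sup>3\<close> on which the form with \<open>\<sigma>\<close> is nonnegative. Below,
  both \<open>\<Sigma>\<close> and \<open>Int D\<^sup>3\<close> are intersected with \<open>\<real>\<^sup>3\<close>.
\<close>

definition sphere_of :: "minkowski \<Rightarrow> (real^3) set" where
  "sphere_of \<sigma> = {p. lorentz \<sigma> (light_point p) = 0}"

definition int_side :: "minkowski \<Rightarrow> (real^3) set" where
  "int_side \<sigma> = {p. lorentz \<sigma> (light_point p) > 0}"

text \<open>
  The round sphere with center \<open>c\<close> and radius \<open>r\<close>; for \<open>e = 1\<close> the side \<open>D\<^sup>3\<close> is the ball, for
  \<open>e = -1\<close> it is the exterior. The remaining elements of \<open>Lambda\<close> are the oriented planes.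
\<close>

definition round_sphere :: "real \<Rightarrow> real^3 \<Rightarrow> real \<Rightarrow> minkowski" where
  "round_sphere e c r =
     (e / r) *\<^sub>R (c, ((norm c)\<^sup>2 - r\<^sup>2 - 1) / 2, ((norm c)\<^sup>2 - r\<^sup>2 + 1) / 2)"

definition oriented_plane :: "real^3 \<Rightarrow> real \<Rightarrow> minkowski" where
  "oriented_plane n d = (n, d, d)"

lemma lorentz_round_sphere:
  assumes "r > 0"
  shows "lorentz (round_sphere e c r) (light_point p) = e * (r\<^sup>2 - (dist p c)\<^sup>2) / (2 * r)"
proof -
  have d: "(dist p c)\<^sup>2 = (norm p)\<^sup>2 + (norm c)\<^sup>2 - 2 * (c \<bullet> p)"
    unfolding dist_norm power2_norm_eq_inner
    by (simp add: inner_diff_left inner_diff_right inner_commute)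
  have l: "lorentz (round_sphere e c r) (light_point p) =
      (e / r) * (c \<bullet> p + ((norm c)\<^sup>2 - r\<^sup>2 - 1) / 2 * (((norm p)\<^sup>2 - 1) / 2)
        - ((norm c)\<^sup>2 - r\<^sup>2 + 1) / 2 * (((norm p)\<^sup>2 + 1) / 2))"
    unfolding lorentz_def round_sphere_def light_point_def
    by (simp only: prod.case scaleR_Pair inner_scaleR_left real_scaleR_def distrib_left
        right_diff_distrib mult.assoc)
  have "((A - R - 1) / 2) * ((P - 1) / 2) - ((A - R + 1) / 2) * ((P + 1) / 2) =
      (R - A - P) / 2" for A R P :: real
    by (simp add: field_simps)
  from this[of "(norm c)\<^sup>2" "r\<^sup>2" "(norm p)\<^sup>2"]
  have q: "c \<bullet> p + ((norm c)\<^sup>2 - r\<^sup>2 - 1) / 2 * (((norm p)\<^sup>2 - 1) / 2)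
        - ((norm c)\<^sup>2 - r\<^sup>2 + 1) / 2 * (((norm p)\<^sup>2 + 1) / 2)
      = (r\<^sup>2 - ((norm p)\<^sup>2 + (norm c)\<^sup>2 - 2 * (c \<bullet> p))) / 2"
    by (simp add: field_simps)
  show ?thesis
    unfolding l q d by simp
qed

lemma lorentz_round_sphere_self:
  assumes "r > 0"
  shows "lorentz (round_sphere e c r) (round_sphere e c r) = e\<^sup>2"
proof -
  have "(norm c)\<^sup>2 + (((norm c)\<^sup>2 - r\<^sup>2 - 1) / 2)\<^sup>2 - (((norm c)\<^sup>2 - r\<^sup>2 + 1) / 2)\<^sup>2 = r\<^sup>2"
    by (simp add: field_simps power2_eq_square)
  then have *: "c \<bullet> c + (((norm c)\<^sup>2 - r\<^sup>2 - 1) / 2)\<^sup>2 - (((norm c)\<^sup>2 - r\<^sup>2 + 1) / 2)\<^sup>2 = r\<^sup>2"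
    by (simp add: power2_norm_eq_inner)
  have "lorentz (round_sphere e c r) (round_sphere e c r) =
     (e / r)\<^sup>2 * (c \<bullet> c + (((norm c)\<^sup>2 - r\<^sup>2 - 1) / 2)\<^sup>2 - (((norm c)\<^sup>2 - r\<^sup>2 + 1) / 2)\<^sup>2)"
    unfolding lorentz_def round_sphere_def
    by (simp add: power2_eq_square algebra_simps add_divide_distrib diff_divide_distrib)
  also have "\<dots> = e\<^sup>2"
    using assms unfolding * by (simp add: power_divide)
  finally show ?thesis .
qed

lemma round_sphere_geometry:
  assumes "r > 0"
  shows "round_sphere 1 c r \<in> Lambda" "round_sphere (-1) c r \<in> Lambda"
    and "sphere_of (round_sphere 1 c r) = sphere c r"
    and "sphere_of (round_sphere (-1) c r) = sphere c r"
    and "int_side (round_sphere 1 c r) = ball c r"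
    and "int_side (round_sphere (-1) c r) = - cball c r"
proof -
  have sq: "(dist p c)\<^sup>2 = r\<^sup>2 \<longleftrightarrow> dist c p = r" "(dist p c)\<^sup>2 < r\<^sup>2 \<longleftrightarrow> dist c p < r"
    "r\<^sup>2 < (dist p c)\<^sup>2 \<longleftrightarrow> \<not> dist c p \<le> r" for p
  proof -
    show "(dist p c)\<^sup>2 = r\<^sup>2 \<longleftrightarrow> dist c p = r"
      using power2_eq_iff_nonneg[of r "dist p c"] assms by (auto simp: dist_commute)
    show "(dist p c)\<^sup>2 < r\<^sup>2 \<longleftrightarrow> dist c p < r"
      using power_mono_iff[of r "dist p c" 2] assms by (auto simp: dist_commute not_le[symmetric])
    show "r\<^sup>2 < (dist p c)\<^sup>2 \<longleftrightarrow> \<not> dist c p \<le> r"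
      using power_mono_iff[of "dist p c" r 2] assms by (auto simp: dist_commute not_le[symmetric])
  qed
  have pos: "0 < x / (2 * r) \<longleftrightarrow> 0 < x" "x / (2 * r) = 0 \<longleftrightarrow> x = 0" for x
    using assms by (auto simp: zero_less_divide_iff)
  show "round_sphere 1 c r \<in> Lambda" "round_sphere (-1) c r \<in> Lambda"
    using assms by (auto simp: Lambda_def lorentz_round_sphere_self)
  show "sphere_of (round_sphere 1 c r) = sphere c r"
    "sphere_of (round_sphere (-1) c r) = sphere c r"
    by (simp_all add: set_eq_iff sphere_of_def lorentz_round_sphere[OF assms] pos sq(1)
        eq_commute[of "r\<^sup>2" "(dist _ c)\<^sup>2"] del: divide_eq_0_iff)
  show "int_side (round_sphere 1 c r) = ball c r"
    by (simp add: set_eq_iff int_side_def lorentz_round_sphere[OF assms] pos sq(2))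
  show "int_side (round_sphere (-1) c r) = - cball c r"
    by (simp add: set_eq_iff int_side_def lorentz_round_sphere[OF assms] pos sq(3))
qed

lemma oriented_plane_geometry:
  assumes "norm n = 1"
  shows "oriented_plane n d \<in> Lambda"
    and "sphere_of (oriented_plane n d) = {p. n \<bullet> p = d}"
    and "int_side (oriented_plane n d) = {p. n \<bullet> p > d}"
proof -
  have "n \<bullet> n = 1"
    using assms by (simp add: power2_norm_eq_inner[symmetric])
  then show "oriented_plane n d \<in> Lambda"
    by (simp add: Lambda_def lorentz_def oriented_plane_def)
  have "lorentz (oriented_plane n d) (light_point p) = n \<bullet> p - d" for p
    by (simp add: lorentz_def oriented_plane_def light_point_def field_simps)
  then show "sphere_of (oriented_plane n d) = {p. n \<bullet> p = d}"
    "int_side (oriented_plane n d) = {p. n \<bullet> p > d}"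
    by (auto simp: sphere_of_def int_side_def)
qed

lemma Lambda_cases:
  assumes "\<sigma> \<in> Lambda"
  obtains (round) c r where "r > 0" "\<sigma> = round_sphere 1 c r \<or> \<sigma> = round_sphere (-1) c r"
        | (plane) n d where "norm n = 1" "\<sigma> = oriented_plane n d"
proof -
  obtain u a b where \<sigma>: "\<sigma> = (u, a, b)" by (cases \<sigma>) auto
  have L: "(norm u)\<^sup>2 + a\<^sup>2 - b\<^sup>2 = 1"
    using assms unfolding power2_norm_eq_inner
    by (simp add: Lambda_def lorentz_def \<sigma> power2_eq_square)
  show ?thesis
  proof (cases "a = b")
    case True
    then have "norm u = 1" using L by (simp add: power2_eq_1_iff) (smt (verit) norm_ge_zero)
    then show ?thesis using plane[of u a] True \<sigma> by (simp add: oriented_plane_def)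
  next
    case False
    define k where "k = b - a"
    have k: "k \<noteq> 0" using False by (simp add: k_def)
    define c where "c = (1 / k) *\<^sub>R u"
    have b: "b = a + k" by (simp add: k_def)
    have "(norm u)\<^sup>2 = 1 + 2 * a * k + k\<^sup>2"
      using L by (simp add: b power2_eq_square algebra_simps)
    then have nc: "(norm c)\<^sup>2 - (1 / k)\<^sup>2 = 2 * a / k + 1"
      using k by (simp add: c_def power_mult_distrib power_divide field_simps power2_eq_square)
    have "\<sigma> = k *\<^sub>R (c, ((norm c)\<^sup>2 - (1 / k)\<^sup>2 - 1) / 2, ((norm c)\<^sup>2 - (1 / k)\<^sup>2 + 1) / 2)"
      unfolding nc using k by (simp add: \<sigma> c_def b field_simps)
    then have "\<sigma> = round_sphere (sgn k) c (1 / \<bar>k\<bar>)"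
      using k by (simp add: round_sphere_def power_divide sgn_mult_abs)
    then show ?thesis
      using round[of "1 / \<bar>k\<bar>" c] k by (auto simp: sgn_if split: if_splits)
  qed
qed

text \<open>
  The invariant measure, given by the density \<open>1 / r\<^sup>4\<close> in the coordinates (center, radius) on each
  of the two families of oriented round spheres. The planes form a null set.
\<close>

definition radius_measure :: "((real^3) \<times> real) measure" where
  "radius_measure =
     density (restrict_space lborel {(c, r). 0 < r}) (\<lambda>(c, r). ennreal (1 / r ^ 4))"

definition dSigma :: "minkowski measure" where
  "dSigma = distr (radius_measure \<Otimes>\<^sub>M count_space {1, -1}) (restrict_space borel Lambda)
     (\<lambda>((c, r), e). round_sphere e c r)"

lemma space_radius_measure: "space radius_measure = {(c, r). 0 < r}"
  by (simp add: radius_measure_def space_restrict_space)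

lemma sets_radius_measure [measurable_cong]:
  "sets radius_measure = sets (restrict_space borel {(c, r). 0 < r})"
  by (simp add: radius_measure_def sets_restrict_space)

lemma round_sphere_measurable:
  "(\<lambda>((c, r), e). round_sphere e c r) \<in>
     radius_measure \<Otimes>\<^sub>M count_space {1, -1} \<rightarrow>\<^sub>M restrict_space borel Lambda"
proof -
  have iff: "g \<in> radius_measure \<Otimes>\<^sub>M count_space {1, -1} \<rightarrow>\<^sub>M N \<longleftrightarrow>
    g \<in> restrict_space borel {(c, r). 0 < r} \<Otimes>\<^sub>M count_space {1, -1} \<rightarrow>\<^sub>M N"
    for g :: "((real^3) \<times> real) \<times> real \<Rightarrow> minkowski" and N
    by (subst measurable_cong_sets[OF sets_pair_measure_cong[OF sets_radius_measure refl] refl]) simp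
  have [measurable]: "(\<lambda>x. round_sphere e (fst x) (snd x)) \<in> borel_measurable borel" for e
    unfolding round_sphere_def borel_prod[symmetric] scaleR_Pair
    by (intro measurable_Pair) measurable
  have "(\<lambda>x. round_sphere (snd x) (fst (fst x)) (snd (fst x))) \<in>
      restrict_space borel {(c, r). 0 < r} \<Otimes>\<^sub>M count_space {1, -1} \<rightarrow>\<^sub>M borel"
    by (rule measurable_compose_countable'[where I = "{1, -1}" and g = snd
          and f = "\<lambda>e x. round_sphere e (fst (fst x)) (snd (fst x))"])
       (auto intro!: measurable_compose[OF measurable_fst] measurable_restrict_space1)
  then show ?thesis
    unfolding iff split_beta
    by (intro measurable_restrict_space2)
       (auto simp: space_pair_measure space_restrict_space round_sphere_geometry)
qed

lemma nn_integral_dSigma: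
  assumes [measurable]: "F \<in> borel_measurable (restrict_space borel Lambda)"
  shows "(\<integral>\<^sup>+ \<sigma>. F \<sigma> \<partial>dSigma) =
    (\<Sum>e\<in>{1, -1}. \<integral>\<^sup>+ x. (case x of (c, r) \<Rightarrow>
        ennreal (1 / r ^ 4) * F (round_sphere e c r)) * indicator {(c, r). 0 < r} x \<partial>lborel)"
proof -
  interpret C: sigma_finite_measure "count_space {1, -1 :: real}"
    by (rule sigma_finite_measure_count_space_finite) simp
  have S: "{(c, r). 0 < r} \<in> sets (borel :: ((real^3) \<times> real) measure)"
    unfolding split_beta by (intro borel_open open_Collect_less continuous_intros)
  have R[measurable]: "(\<lambda>x. F (round_sphere e (fst x) (snd x))) \<in> borel_measurable radius_measure"
    if "e \<in> {1, -1}" for e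
    using measurable_compose[OF measurable_compose[OF measurable_Pair2'[of e "count_space {1, -1}"]
        round_sphere_measurable] assms] that
    by (simp add: split_beta)
  have D: "(\<lambda>(c, r). ennreal (1 / r ^ 4)) \<in> borel_measurable
      (restrict_space (lborel :: ((real^3) \<times> real) measure) {(c, r). 0 < r})"
    by (rule measurable_restrict_space1) (simp add: borel_prod[symmetric])
  have "(\<integral>\<^sup>+ \<sigma>. F \<sigma> \<partial>dSigma) =
      (\<integral>\<^sup>+ y. F ((\<lambda>((c, r), e). round_sphere e c r) y)
         \<partial>(radius_measure \<Otimes>\<^sub>M count_space {1, -1}))"
    unfolding dSigma_def using assms
    by (intro nn_integral_distr round_sphere_measurable) (simp only: measurable_distr_eq1)
  also have "\<dots> = (\<integral>\<^sup>+ x. \<integral>\<^sup>+ e. F ((\<lambda>((c, r), e). round_sphere e c r) (x, e))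
         \<partial>count_space {1, -1} \<partial>radius_measure)"
    by (rule C.nn_integral_fst[symmetric]) (rule measurable_compose[OF round_sphere_measurable assms])
  also have "\<dots> = (\<integral>\<^sup>+ x. (\<Sum>e\<in>{1, -1}. F (round_sphere e (fst x) (snd x))) \<partial>radius_measure)"
    by (simp add: nn_integral_count_space_finite split_beta)
  also have "\<dots> = (\<Sum>e\<in>{1, -1}. \<integral>\<^sup>+ x. F (round_sphere e (fst x) (snd x)) \<partial>radius_measure)"
    by (rule nn_integral_sum) (rule R)
  also have "\<dots> = (\<Sum>e\<in>{1, -1}. \<integral>\<^sup>+ x. (case x of (c, r) \<Rightarrow>
        ennreal (1 / r ^ 4) * F (round_sphere e c r)) * indicator {(c, r). 0 < r} x \<partial>lborel)"
  proof (rule sum.cong[OF refl])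
    fix e :: real assume e: "e \<in> {1, -1}"
    have "(\<lambda>x. F (round_sphere e (fst x) (snd x))) \<in>
        borel_measurable (restrict_space lborel {(c, r). 0 < r})"
      using R[OF e] unfolding radius_measure_def by simp
    then show "(\<integral>\<^sup>+ x. F (round_sphere e (fst x) (snd x)) \<partial>radius_measure) =
        (\<integral>\<^sup>+ x. (case x of (c, r) \<Rightarrow>
          ennreal (1 / r ^ 4) * F (round_sphere e c r)) * indicator {(c, r). 0 < r} x \<partial>lborel)"
      unfolding radius_measure_def using S
      by (subst nn_integral_density[OF D])
         (auto simp: nn_integral_restrict_space split_beta)
  qed
  finally show ?thesis .
qed

section \<open>Non-trivial spheres and the measure of acyclicity\<close>

definition nontrivial_spheres :: "(real^3) set \<Rightarrow> minkowski set" where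
  "nontrivial_spheres K =
     {\<sigma> \<in> Lambda. \<exists>A B. A \<in> components (K - sphere_of \<sigma>) \<and> B \<in> components (K - sphere_of \<sigma>) \<and>
        A \<noteq> B \<and> A \<subseteq> int_side \<sigma> \<inter> K \<and> B \<subseteq> int_side \<sigma> \<inter> K}"

text \<open>
  The multiplicity of an intersection point \<open>p\<close> is the order of vanishing at \<open>p\<close>, along the knot,
  of the function \<open>q \<mapsto> lorentz \<sigma> (light_point q)\<close>, which is a defining function of the sphere
  (nonzero gradient on it). It is 1 exactly at the transverse intersection points.
\<close>

definition multiplicity_at :: "(real^3) set \<Rightarrow> minkowski \<Rightarrow> real^3 \<Rightarrow> enat" where
  "multiplicity_at K \<sigma> p =
     Sup {enat m | m. (\<lambda>q. lorentz \<sigma> (light_point q)) \<in> O[at p within K](\<lambda>q. dist q p ^ m)}"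

definition intersection_number :: "(real^3) set \<Rightarrow> minkowski \<Rightarrow> ennreal" where
  "intersection_number K \<sigma> =
     (\<Sum>\<^sub>\<infinity>p\<in>sphere_of \<sigma> \<inter> K. ennreal_of_enat (multiplicity_at K \<sigma> p))"

definition half_intersection_number :: "(real^3) set \<Rightarrow> minkowski \<Rightarrow> ennreal" where
  "half_intersection_number K \<sigma> = intersection_number K \<sigma> / 2"

text \<open>
  \<open>n\<close> choose 2 for \<open>n\<close> in \<open>[1, \<infinity>]\<close>, which includes all values of \<open>half_intersection_number\<close> on
  non-trivial spheres, so that the subtraction is never truncated.
\<close>

definition choose_two :: "ennreal \<Rightarrow> ennreal" where
  "choose_two n = n * (n - 1) / 2"

definition mnts :: "(real^3) set \<Rightarrow> ennreal" where
  "mnts K = (\<integral>\<^sup>+ \<sigma> \<in> nontrivial_spheres K. choose_two (half_intersection_number K \<sigma>) \<partial>dSigma)"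

end

theory Submission
  imports Defs
begin

text \<open>
  Let \<open>x\<close>, \<open>y\<close> be the given points, \<open>l\<close> the length of the knot, and \<open>R = \<rho> l\<close> with a small constant
  \<open>\<rho>\<close> depending on \<open>b\<close> and \<open>\<delta>\<close>. There are two reasons for a large measure of acyclicity, and one of
  them always applies.
  
  If both arcs between \<open>x\<close> and \<open>y\<close> leave the ball of radius \<open>R\<close> about \<open>x\<close>, then every sphere of
  radius between \<open>2 C l\<close> and \<open>R / 2\<close> whose center is close to \<open>x\<close>, compared with its radius, has \<open>x\<close>
  and \<open>y\<close> inside and a point of each arc outside. It is non-trivial and meets the knot at least
  four times. The density \<open>1 / r ^ 4\<close> gives these spheres the measure \<open>(pi / 48) ln (\<rho> / (4 C))\<close>,
  which tends to infinity as \<open>C\<close> tends to 0 (\<open>mnts_ge_ln\<close>).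
  
  Otherwise an arc of length at least \<open>\<delta> l\<close>, hence a piece of it of length at least \<open>\<delta> l / 2\<close> that does
  not pass the base point of the parametrization, is confined to a ball of radius \<open>R\<close>. A
  Cauchy-Crofton argument then applies (\<open>mnts_ge_length\<close>): spheres of radius comparable to \<open>R\<close> meet a
  long arc in a small ball many times on average. In place of the exact integral formula, which
  would require the transversality of almost all spheres, an inscribed polygon with vertices
  \<open>p 0, \<dots>, p N\<close> is used. For a sphere let \<open>D\<close> be the number of \<open>i\<close> with \<open>p i\<close> inside and
  \<open>p (Suc i)\<close> outside. Each such \<open>i\<close> gives an intersection point between the two vertices, and
  \<open>D \<ge> 2\<close> makes the sphere non-trivial; so the integrand is at least \<open>D / 2 - 2\<close>. The spheres that
  separate \<open>p i\<close> from \<open>p (Suc i)\<close> have a measure of at least a constant times \<open>dist (p i) (p (Suc i)) / R\<close>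
  (\<open>emeasure_separating_balls\<close>), and the sum over \<open>i\<close> is comparable to length over \<open>R\<close>.
  
  In both cases the integrand is replaced by a function that depends only on the signs of finitely
  many Lorentz products, because the Lebesgue integral of such a function can be computed
  without knowing that the set of non-trivial spheres or the intersection number is measurable.
\<close>

section \<open>Knots as simple closed curves\<close>

text \<open>
  The knot seen through its angle coordinate on the whole line: an arc that passes the base point
  of the circle is then still the image of an interval.
\<close>

locale simple_closed_curve =
  fixes \<gamma> :: "real \<Rightarrow> real^3" and K :: "(real^3) set"
  assumes cont: "continuous_on UNIV \<gamma>"
    and periodic: "\<gamma> (t + 2 * pi) = \<gamma> t"
    and inj: "inj_on \<gamma> {a..<a + 2 * pi}"
    and K_eq: "K = range \<gamma>"

lemma simple_closed_curve_of_embedding: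
  assumes "C2_embedding f"
  shows "simple_closed_curve (\<lambda>t. f (cis t)) (f ` sphere 0 1)"
proof
  obtain f' where "\<And>t. ((\<lambda>t. f (cis t)) has_vector_derivative f' t) (at t)"
    using assms unfolding C2_embedding_def by blast
  then show "continuous_on UNIV (\<lambda>t. f (cis t))"
    by (meson continuous_at_imp_continuous_on has_vector_derivative_continuous)
  show "f (cis (t + 2 * pi)) = f (cis t)" for t
    by (simp add: cis_mult[symmetric])
  show "inj_on (\<lambda>t. f (cis t)) {a..<a + 2 * pi}" for a
  proof (rule inj_onI)
    fix u v assume uv: "u \<in> {a..<a + 2 * pi}" "v \<in> {a..<a + 2 * pi}" "f (cis u) = f (cis v)"
    have "inj_on f (sphere 0 1)"
      using assms unfolding C2_embedding_def by blast
    then have "cis u = cis v"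
      using uv(3) by (auto dest: inj_onD)
    then have "sin u = sin v \<and> cos u = cos v"
      by (simp add: complex_eq_iff)
    then obtain n :: int where n: "u = v + 2 * pi * n"
      unfolding sin_cos_eq_iff by auto
    have "\<bar>u - v\<bar> < 2 * pi"
      using uv by auto
    then have "2 * pi * \<bar>real_of_int n\<bar> < 2 * pi * 1"
      using n by (simp add: abs_mult)
    then have "\<bar>real_of_int n\<bar> < 1"
      using pi_gt_zero by (subst (asm) mult_less_cancel_left_pos) auto
    then have "n = 0"
      by linarith
    then show "u = v"
      using n by simp
  qed
  show "f ` sphere 0 1 = range (\<lambda>t. f (cis t))"
  proof -
    have "z \<in> range cis" if "norm z = 1" for z
      using that by (metis cis_Arg norm_zero rangeI sgn_eq zero_neq_one div_by_1 of_real_1)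
    then have "sphere 0 1 = range cis"
      by auto
    then show ?thesis
      by (simp add: image_image)
  qed
qed

section \<open>The sides of a sphere\<close>

lemma lorentz_light_point_eq:
  "lorentz (u, a, b) (light_point p) = u \<bullet> p + a * (((norm p)\<^sup>2 - 1) / 2) - b * (((norm p)\<^sup>2 + 1) / 2)"
  by (simp add: lorentz_def light_point_def)

lemma continuous_on_lorentz_point [continuous_intros]:
  assumes "continuous_on S g"
  shows "continuous_on S (\<lambda>x. lorentz \<sigma> (light_point (g x)))"
  by (cases \<sigma>) (auto simp: lorentz_light_point_eq intro!: continuous_intros assms)

lemma continuous_on_lorentz_sphere:
  "continuous_on S (\<lambda>\<sigma>. lorentz \<sigma> (light_point p))"
  unfolding lorentz_def light_point_def split_beta
  by (auto intro!: continuous_intros)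

lemma borel_measurable_lorentz [measurable]:
  "(\<lambda>\<sigma>. lorentz \<sigma> (light_point p)) \<in> borel_measurable borel"
  by (rule borel_measurable_continuous_onI) (rule continuous_on_lorentz_sphere)

text \<open>
  The defining function of the sphere has no zero on \<open>A\<close>, so it cannot change sign there.
\<close>

lemma connected_subset_int_side:
  assumes "connected A" "A \<inter> sphere_of \<sigma> = {}" "p \<in> A" "lorentz \<sigma> (light_point p) > 0"
  shows "A \<subseteq> int_side \<sigma>"
proof
  fix q assume q: "q \<in> A"
  let ?g = "\<lambda>q. lorentz \<sigma> (light_point q)"
  have "connected (?g ` A)"
    by (intro connected_continuous_image continuous_intros assms)
  then have "0 \<in> ?g ` A" if "?g q \<le> 0"
    using that q assms(3,4) unfolding connected_iff_interval by (metis imageI less_imp_le)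
  moreover have "0 \<notin> ?g ` A"
    using assms(2) by (auto simp: sphere_of_def)
  ultimately show "q \<in> int_side \<sigma>"
    by (force simp: int_side_def)
qed

lemma lorentz_round_sphere_pos_iff:
  "r > 0 \<Longrightarrow> lorentz (round_sphere 1 c r) (light_point p) > 0 \<longleftrightarrow> dist p c < r"
  using round_sphere_geometry(5)[of r c] by (auto simp: int_side_def set_eq_iff dist_commute)

lemma lorentz_round_sphere_neg_iff:
  assumes "r > 0"
  shows "lorentz (round_sphere 1 c r) (light_point p) < 0 \<longleftrightarrow> r < dist p c"
proof -
  have "lorentz (round_sphere 1 c r) (light_point p) = - lorentz (round_sphere (-1) c r) (light_point p)"
    unfolding lorentz_round_sphere[OF assms] by (simp add: minus_divide_left)
  then show ?thesis
    using round_sphere_geometry(6)[OF assms, of c] by (auto simp: int_side_def set_eq_iff dist_commute)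
qed

section \<open>Non-trivial spheres and intersection points\<close>

context simple_closed_curve
begin

lemma periodic_minus: "\<gamma> (t - 2 * pi) = \<gamma> t"
  using periodic[of "t - 2 * pi"] by simp

lemma K_image: "K = \<gamma> ` {a..<a + 2 * pi}"
proof -
  have "\<gamma> t \<in> \<gamma> ` {a..<a + 2 * pi}" for t
  proof -
    have per: "\<gamma> (t + 2 * pi * of_int n) = \<gamma> t" for n :: int
    proof (induction n rule: int_induct[where k = 0])
      case (step1 i)
      then show ?case using periodic[of "t + 2 * pi * of_int i"] by (simp add: algebra_simps)
    next
      case (step2 i)
      then show ?case using periodic_minus[of "t + 2 * pi * of_int i"] by (simp add: algebra_simps)
    qed simp
    define n where "n = - \<lfloor>(t - a) / (2 * pi)\<rfloor>"
    have "- of_int n \<le> (t - a) / (2 * pi)" "(t - a) / (2 * pi) < - of_int n + 1"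
      unfolding n_def by linarith+
    then have "- of_int n * (2 * pi) \<le> t - a" "t - a < (- of_int n + 1) * (2 * pi)"
      by (simp_all only: pos_le_divide_eq pos_divide_less_eq pi_gt_zero zero_less_mult_iff
          zero_less_numeral simp_thms)
    then have "t + 2 * pi * of_int n \<in> {a..<a + 2 * pi}"
      by (simp add: algebra_simps)
    then show ?thesis
      using per[of n] by (metis imageI)
  qed
  then show ?thesis
    unfolding K_eq by auto
qed

lemma arcs_meet_at_endpoints:
  assumes "u1 \<le> u2" "u2 \<le> u1 + 2 * pi"
  shows "\<gamma> ` {u1..u2} \<inter> \<gamma> ` {u2..u1 + 2 * pi} \<subseteq> {\<gamma> u1, \<gamma> u2}"
proof
  fix p assume "p \<in> \<gamma> ` {u1..u2} \<inter> \<gamma> ` {u2..u1 + 2 * pi}"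
  then obtain v w where vw: "v \<in> {u1..u2}" "w \<in> {u2..u1 + 2 * pi}" "p = \<gamma> v" "p = \<gamma> w"
    by blast
  consider "w = u1 + 2 * pi" | "v = u1 + 2 * pi" | "v < u1 + 2 * pi" "w < u1 + 2 * pi"
    using vw assms by force
  then show "p \<in> {\<gamma> u1, \<gamma> u2}"
  proof cases
    case 3
    then have "v = w"
      using vw assms by (intro inj_onD[OF inj[of u1]]) auto
    then show ?thesis
      using vw by auto
  qed (use vw periodic in auto)
qed

text \<open>
  The two outside points cut the knot into two closed arcs that meet only in these points. A
  component of the knot minus the sphere which lies inside contains neither of them, so by
  connectedness it stays in one arc, while \<open>\<gamma> s1\<close> and \<open>\<gamma> s2\<close> lie in different arcs.
\<close>

lemma nontrivial_if_alternating:
  assumes \<sigma>: "\<sigma> \<in> Lambda"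
    and order: "s1 \<le> u1" "u1 \<le> s2" "s2 \<le> u2" "u2 \<le> s1 + 2 * pi"
    and inside: "lorentz \<sigma> (light_point (\<gamma> s1)) > 0" "lorentz \<sigma> (light_point (\<gamma> s2)) > 0"
    and outside: "lorentz \<sigma> (light_point (\<gamma> u1)) < 0" "lorentz \<sigma> (light_point (\<gamma> u2)) < 0"
  shows "\<sigma> \<in> nontrivial_spheres K"
proof -
  define U where "U = K - sphere_of \<sigma>"
  define A where "A = connected_component_set U (\<gamma> s1)"
  define B where "B = connected_component_set U (\<gamma> s2)"
  have U: "\<gamma> s1 \<in> U" "\<gamma> s2 \<in> U"
    using inside by (auto simp: U_def K_eq sphere_of_def)
  have comps: "A \<in> components U" "B \<in> components U"
    using U unfolding A_def B_def by (auto intro: componentsI)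
  have mem: "\<gamma> s1 \<in> A" "\<gamma> s2 \<in> B"
    using U unfolding A_def B_def by (auto simp: connected_component_refl)
  have sub: "A \<subseteq> U" "B \<subseteq> U"
    unfolding A_def B_def by (rule connected_component_subset)+
  have conn: "connected A" "connected B"
    unfolding A_def B_def by (rule connected_connected_component)+
  have side: "A \<subseteq> int_side \<sigma>" "B \<subseteq> int_side \<sigma>"
    using connected_subset_int_side[OF conn(1) _ mem(1) inside(1)]
      connected_subset_int_side[OF conn(2) _ mem(2) inside(2)] sub
    unfolding U_def by blast+
  have "A \<noteq> B"
  proof
    assume AB: "A = B"
    let ?P = "\<gamma> ` {u1..u2}" and ?Q = "\<gamma> ` {u2..u1 + 2 * pi}"
    have cl: "closed ?P" "closed ?Q"
      by (intro compact_imp_closed compact_continuous_image continuous_on_subset[OF cont] compact_Icc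
          subset_UNIV)+
    have "{u1..<u1 + 2 * pi} \<subseteq> {u1..u2} \<union> {u2..u1 + 2 * pi}"
      by auto
    then have "K \<subseteq> ?P \<union> ?Q"
      unfolding K_image[of u1] image_Un[symmetric] by (rule image_mono)
    then have cover: "A \<subseteq> ?P \<union> ?Q"
      using sub unfolding U_def by blast
    have "?P \<inter> ?Q \<inter> A \<subseteq> {\<gamma> u1, \<gamma> u2} \<inter> A"
      using order by (intro Int_mono arcs_meet_at_endpoints) auto
    also have "\<dots> = {}"
      using side(1) outside by (auto simp: int_side_def)
    finally have "?P \<inter> ?Q \<inter> A = {}"
      by simp
    moreover have "\<gamma> s2 \<in> ?P \<inter> A"
      using mem AB order by auto
    moreover have "\<gamma> (s1 + 2 * pi) \<in> ?Q"
      using order by (intro imageI) auto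
    then have "\<gamma> s1 \<in> ?Q \<inter> A"
      using mem periodic by simp
    ultimately show False
      using connected_closedD[OF conn(1) _ cover cl] by (metis empty_iff)
  qed
  moreover have "A \<subseteq> int_side \<sigma> \<inter> K" "B \<subseteq> int_side \<sigma> \<inter> K"
    using side sub unfolding U_def by blast+
  ultimately show ?thesis
    using \<sigma> comps unfolding nontrivial_spheres_def U_def
    by (intro CollectI conjI exI[of _ A] exI[of _ B]) simp_all
qed

end

text \<open>
  The defining function is a polynomial of degree at most 2, hence Lipschitz near each of its zeros.
\<close>

lemma multiplicity_at_ge_1:
  assumes "p \<in> sphere_of \<sigma>"
  shows "1 \<le> multiplicity_at K \<sigma> p"
proof -
  let ?g = "\<lambda>q. lorentz \<sigma> (light_point q)"
  obtain u a b where \<sigma>: "\<sigma> = (u, a, b)"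
    by (cases \<sigma>) auto
  define M where "M = norm u + \<bar>a - b\<bar> * (norm p + 1)"
  have "norm (?g q) \<le> M * norm (dist q p ^ 1)" if "dist q p < 1" for q
  proof -
    have "?g q = ?g q - ?g p"
      using assms by (simp add: sphere_of_def)
    also have "\<dots> = u \<bullet> (q - p) + (a - b) / 2 * ((norm q - norm p) * (norm q + norm p))"
      by (simp add: \<sigma> lorentz_light_point_eq inner_diff_right power2_eq_square field_simps)
    finally have eq: "norm (?g q) =
        \<bar>u \<bullet> (q - p) + (a - b) / 2 * ((norm q - norm p) * (norm q + norm p))\<bar>"
      by simp
    have d: "\<bar>norm q - norm p\<bar> \<le> dist q p"
      by (simp add: dist_norm norm_triangle_ineq3)
    have s: "\<bar>norm q + norm p\<bar> \<le> 2 * (norm p + 1)"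
      using abs_le_D1[OF d] that by simp
    have "\<bar>(a - b) / 2 * ((norm q - norm p) * (norm q + norm p))\<bar>
        = \<bar>a - b\<bar> / 2 * (\<bar>norm q - norm p\<bar> * \<bar>norm q + norm p\<bar>)"
      by (simp add: abs_mult)
    also have "\<dots> \<le> \<bar>a - b\<bar> / 2 * (dist q p * (2 * (norm p + 1)))"
      by (intro mult_left_mono mult_mono d s) auto
    also have "\<dots> = \<bar>a - b\<bar> * (norm p + 1) * dist q p"
      by simp
    moreover have "\<bar>u \<bullet> (q - p)\<bar> \<le> norm u * dist q p"
      by (simp add: dist_norm Cauchy_Schwarz_ineq2)
    ultimately have "norm (?g q) \<le> norm u * dist q p + \<bar>a - b\<bar> * (norm p + 1) * dist q p"
      unfolding eq by linarith
    then show ?thesis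
      by (simp add: M_def distrib_right)
  qed
  then have "?g \<in> O[at p within K](\<lambda>q. dist q p ^ 1)"
    by (intro bigoI[of _ M]) (auto simp: eventually_at intro!: exI[of _ 1])
  then have "enat 1 \<in> {enat m | m. ?g \<in> O[at p within K](\<lambda>q. dist q p ^ m)}"
    by blast
  then show ?thesis
    unfolding multiplicity_at_def one_enat_def by (rule Sup_upper)
qed

lemma (in simple_closed_curve) card_le_intersection_number:
  assumes "Z \<subseteq> {a..<a + 2 * pi}" "finite Z" "\<And>z. z \<in> Z \<Longrightarrow> lorentz \<sigma> (light_point (\<gamma> z)) = 0"
  shows "of_nat (card Z) \<le> intersection_number K \<sigma>"
proof -
  let ?m = "\<lambda>p. ennreal_of_enat (multiplicity_at K \<sigma> p)"
  have sub: "\<gamma> ` Z \<subseteq> sphere_of \<sigma> \<inter> K"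
    using assms(3) by (auto simp: sphere_of_def K_eq)
  have "of_nat (card Z) = (of_nat (card (\<gamma> ` Z)) :: ennreal)"
    using card_image[OF inj_on_subset[OF inj assms(1)]] by simp
  also have "\<dots> = (\<Sum>p\<in>\<gamma> ` Z. 1)"
    by simp
  also have "\<dots> \<le> (\<Sum>p\<in>\<gamma> ` Z. ?m p)"
  proof (rule sum_mono)
    fix p assume "p \<in> \<gamma> ` Z"
    then have "1 \<le> multiplicity_at K \<sigma> p"
      using sub by (intro multiplicity_at_ge_1) auto
    then show "1 \<le> ?m p"
      by (metis ennreal_of_enat_1 ennreal_of_enat_le_iff)
  qed
  also have "\<dots> \<le> (\<Sum>\<^sub>\<infinity>p\<in>sphere_of \<sigma> \<inter> K. ?m p)"
    using assms(2) sub by (subst nonneg_infsum_complete) (auto intro!: SUP_upper)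
  finally show ?thesis
    unfolding intersection_number_def .
qed

lemma choose_two_mono: "m \<le> n \<Longrightarrow> choose_two m \<le> choose_two n"
  unfolding choose_two_def
  by (intro divide_right_mono_ennreal mult_mono ennreal_minus_mono) auto

lemma choose_two_ennreal:
  assumes "x \<ge> 1"
  shows "choose_two (ennreal x) = ennreal (x * (x - 1) / 2)"
proof -
  have "ennreal x - 1 = ennreal (x - 1)"
    using ennreal_minus[of 1 x] by simp
  moreover have "ennreal x * ennreal (x - 1) = ennreal (x * (x - 1))"
    using assms by (simp add: ennreal_mult)
  moreover have "ennreal (x * (x - 1)) / 2 = ennreal (x * (x - 1) / 2)"
    using assms divide_ennreal[of "x * (x - 1)" 2] by simp
  ultimately show ?thesis
    by (simp add: choose_two_def)
qed

text \<open>
  For real \<open>x\<close> one has \<open>x * (x - 1) / 2 \<ge> x - 2\<close>. This linear bound turns a lower bound for the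
  average number of intersection points into one for the measure of acyclicity.
\<close>

lemma choose_two_half_ge:
  assumes "of_nat k \<le> N"
  shows "ennreal (k / 2 - 2) \<le> choose_two (N / 2)"
    and "4 \<le> k \<Longrightarrow> 1 \<le> choose_two (N / 2)"
proof -
  have "ennreal (real k / 2) = of_nat k / 2"
    using divide_ennreal[of "real k" 2] by (simp add: ennreal_of_nat_eq_real_of_nat)
  then have ge: "choose_two (ennreal (real k / 2)) \<le> choose_two (N / 2)"
    using assms by (intro choose_two_mono) (simp add: divide_right_mono_ennreal)
  have ct: "choose_two (ennreal (real k / 2)) = ennreal (k / 2 * (k / 2 - 1) / 2)" if "k \<ge> 2"
    using that by (intro choose_two_ennreal) auto
  have "(x::real) - 2 \<le> x * (x - 1) / 2" for x
  proof -
    have "x * (x - 1) / 2 - (x - 2) = ((x - 3/2)\<^sup>2 + 7/4) / 2"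
      by (simp add: power2_eq_square field_simps)
    also have "\<dots> \<ge> 0"
      by simp
    finally show ?thesis by simp
  qed
  then have "ennreal (k / 2 - 2) \<le> ennreal (k / 2 * (k / 2 - 1) / 2)"
    by (rule ennreal_leI)
  then show "ennreal (k / 2 - 2) \<le> choose_two (N / 2)"
    using order_trans[OF _ ge] ct by (cases "k \<ge> 2") (simp_all only: ennreal_neg, simp_all add: ennreal_neg)
  show "1 \<le> choose_two (N / 2)" if "4 \<le> k"
  proof -
    have "2 * 1 / 2 \<le> k / 2 * (k / 2 - 1) / (2::real)"
      using that by (intro divide_right_mono mult_mono) auto
    then have "ennreal 1 \<le> choose_two (ennreal (real k / 2))"
      using that by (subst ct) (auto intro: ennreal_leI simp del: ennreal_1)
    then show ?thesis
      using ge by simp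
  qed
qed

section \<open>Lower bounds for the integrand by finitely many signs\<close>

text \<open>
  The function \<open>G\<close> makes the integral a concrete one over centers and radii, for which the integrand
  has to be measurable. Of the two orientations only that by the ball is kept.
\<close>

lemma mnts_ge_round_spheres:
  assumes [measurable]: "G \<in> borel_measurable borel"
    and le: "\<And>\<sigma>. \<sigma> \<in> Lambda \<Longrightarrow>
      G \<sigma> \<le> choose_two (half_intersection_number K \<sigma>) * indicator (nontrivial_spheres K) \<sigma>"
  shows "(\<integral>\<^sup>+ (c, r). ennreal (1 / r ^ 4) * G (round_sphere 1 c r) * indicator {0<..} r \<partial>lborel) \<le> mnts K"
    (is "?I \<le> _")
proof -
  let ?J = "\<lambda>e. \<integral>\<^sup>+ x. (case x of (c, r) \<Rightarrow>
        ennreal (1 / r ^ 4) * G (round_sphere e c r)) * indicator {(c, r). 0 < r} x \<partial>lborel"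
  have "?I = ?J 1"
    by (intro nn_integral_cong) (auto simp: indicator_def)
  also have "\<dots> \<le> (\<Sum>e\<in>{1, -1}. ?J e)"
    by simp
  also have "\<dots> = (\<integral>\<^sup>+ \<sigma>. G \<sigma> \<partial>dSigma)"
    by (rule nn_integral_dSigma[symmetric]) (simp add: measurable_restrict_space1)
  also have "\<dots> \<le> mnts K"
    unfolding mnts_def
    by (intro nn_integral_mono le) (simp add: dSigma_def space_restrict_space)
  finally show ?thesis .
qed

text \<open>
  Only the steps from inside to outside are counted: two of them alternate along the curve with
  a return to the inside, so that no parity argument is needed for non-triviality.
\<close>

definition crossing_count :: "(nat \<Rightarrow> real^3) \<Rightarrow> nat \<Rightarrow> minkowski \<Rightarrow> nat" where
  "crossing_count p N \<sigma> = card {i. i < N \<and>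
     lorentz \<sigma> (light_point (p i)) > 0 \<and> lorentz \<sigma> (light_point (p (Suc i))) < 0}"

lemma crossing_count_eq_sum:
  "real (crossing_count p N \<sigma>) = (\<Sum>i<N. indicator {\<sigma>. lorentz \<sigma> (light_point (p i)) > 0 \<and>
     lorentz \<sigma> (light_point (p (Suc i))) < 0} \<sigma>)"
proof -
  have "crossing_count p N \<sigma> = card ({..<N} \<inter> {i. lorentz \<sigma> (light_point (p i)) > 0 \<and>
     lorentz \<sigma> (light_point (p (Suc i))) < 0})"
    unfolding crossing_count_def by (rule arg_cong[where f = card]) auto
  then show ?thesis
    by (simp add: indicator_def sum.If_cases)
qed

lemma borel_measurable_crossing_count [measurable]:
  "(\<lambda>\<sigma>. real (crossing_count p N \<sigma>)) \<in> borel_measurable borel"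
  unfolding crossing_count_eq_sum by measurable

context simple_closed_curve
begin

lemma sign_change_zero:
  assumes "u < v" "lorentz \<sigma> (light_point (\<gamma> u)) * lorentz \<sigma> (light_point (\<gamma> v)) < 0"
  shows "\<exists>z. u < z \<and> z < v \<and> lorentz \<sigma> (light_point (\<gamma> z)) = 0"
proof -
  let ?g = "\<lambda>t. lorentz \<sigma> (light_point (\<gamma> t))"
  have c: "continuous_on {u..v} ?g"
    by (intro continuous_intros continuous_on_subset[OF cont] subset_UNIV)
  have "\<exists>z\<ge>u. z \<le> v \<and> ?g z = 0"
    using assms IVT'[of ?g u 0 v, OF _ _ _ c] IVT2'[of ?g v 0 u, OF _ _ _ c]
    by (auto simp: mult_less_0_iff)
  then obtain z where "u \<le> z" "z \<le> v" "?g z = 0"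
    by auto
  moreover have "z \<noteq> u" "z \<noteq> v"
    using assms(2) \<open>?g z = 0\<close> by auto
  ultimately show ?thesis
    by (intro exI[of _ z]) auto
qed

text \<open>
  Each counted step contains a zero of the defining function in the open parameter interval, and
  these intervals are disjoint; this bounds the intersection number by the count. If the count is
  less than 2, the left-hand side vanishes, so non-triviality is needed only otherwise.
\<close>

lemma crossing_count_le_integrand:
  assumes \<tau>: "strict_mono \<tau>" "\<tau> 0 \<ge> a" "\<tau> N \<le> a + 2 * pi" and \<sigma>: "\<sigma> \<in> Lambda"
  shows "ennreal (crossing_count (\<lambda>i. \<gamma> (\<tau> i)) N \<sigma> / 2 - 2)
    \<le> choose_two (half_intersection_number K \<sigma>) * indicator (nontrivial_spheres K) \<sigma>"
proof -
  let ?g = "\<lambda>t. lorentz \<sigma> (light_point (\<gamma> t))"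
  define I where "I = {i. i < N \<and> ?g (\<tau> i) > 0 \<and> ?g (\<tau> (Suc i)) < 0}"
  have I: "crossing_count (\<lambda>i. \<gamma> (\<tau> i)) N \<sigma> = card I" "finite I"
    by (simp_all add: I_def crossing_count_def)
  have less: "\<tau> i < \<tau> (Suc i)" for i
    using \<tau>(1) by (simp add: strict_mono_def)
  have mono: "\<tau> i \<le> \<tau> j" if "i \<le> j" for i j
    using \<tau>(1) that by (simp add: strict_mono_less_eq)
  have "\<exists>z. \<tau> i < z \<and> z < \<tau> (Suc i) \<and> ?g z = 0" if "i \<in> I" for i
    using that by (intro sign_change_zero less) (auto simp: I_def mult_pos_neg)
  then obtain z where z: "\<And>i. i \<in> I \<Longrightarrow> \<tau> i < z i \<and> z i < \<tau> (Suc i) \<and> ?g (z i) = 0"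
    by metis
  have z_less: "z i < z j" if "i \<in> I" "j \<in> I" "i < j" for i j
    using z[OF that(1)] z[OF that(2)] mono[of "Suc i" j] that(3) by auto
  have "inj_on z I"
  proof (rule inj_onI)
    fix i j assume "i \<in> I" "j \<in> I" "z i = z j"
    then show "i = j"
      using z_less[of i j] z_less[of j i] by (cases i j rule: linorder_cases) auto
  qed
  then have "card (z ` I) = card I"
    by (rule card_image)
  moreover have "of_nat (card (z ` I)) \<le> intersection_number K \<sigma>"
  proof (rule card_le_intersection_number[of _ a])
    show "z ` I \<subseteq> {a..<a + 2 * pi}"
    proof
      fix w assume "w \<in> z ` I"
      then obtain i where i: "i \<in> I" "w = z i" by auto
      then show "w \<in> {a..<a + 2 * pi}"
        using z[OF i(1)] mono[of 0 i] mono[of "Suc i" N] \<tau> by (auto simp: I_def)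
    qed
  qed (use z I in auto)
  ultimately have le: "ennreal (card I / 2 - 2) \<le> choose_two (half_intersection_number K \<sigma>)"
    unfolding half_intersection_number_def by (intro choose_two_half_ge) simp
  show ?thesis
  proof (cases "card I \<ge> 2")
    case True
    then obtain i j where ij: "i \<in> I" "j \<in> I" "i < j"
      by (metis card_2_iff' card_le_Suc0_iff_eq I(2) linorder_neqE_nat not_less_eq_eq numeral_2_eq_2)
    have "\<sigma> \<in> nontrivial_spheres K"
    proof (rule nontrivial_if_alternating[OF \<sigma>])
      show "\<tau> i \<le> \<tau> (Suc i)" "\<tau> (Suc i) \<le> \<tau> j" "\<tau> j \<le> \<tau> (Suc j)"
        using ij by (auto intro: mono)
      show "\<tau> (Suc j) \<le> \<tau> i + 2 * pi"
        using mono[of 0 i] mono[of "Suc j" N] \<tau> ij by (auto simp: I_def)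
    qed (use ij in \<open>auto simp: I_def\<close>)
    then show ?thesis
      using le I by simp
  next
    case False
    then show ?thesis
      using I by (simp add: ennreal_neg)
  qed
qed

text \<open>
  Four sign changes along the closed curve give four intersection points, the last one between \<open>u2\<close>
  and the return to \<open>\<gamma> s\<close>.
\<close>

lemma alternating_le_integrand:
  assumes order: "s < u1" "u1 < t" "t < u2" "u2 < s + 2 * pi" and \<sigma>: "\<sigma> \<in> Lambda"
  shows "indicator {\<sigma>. lorentz \<sigma> (light_point (\<gamma> s)) > 0 \<and> lorentz \<sigma> (light_point (\<gamma> t)) > 0 \<and>
      lorentz \<sigma> (light_point (\<gamma> u1)) < 0 \<and> lorentz \<sigma> (light_point (\<gamma> u2)) < 0} \<sigma>
    \<le> choose_two (half_intersection_number K \<sigma>) * indicator (nontrivial_spheres K) \<sigma>"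
    (is "indicator ?S \<sigma> \<le> _")
proof (cases "\<sigma> \<in> ?S")
  case True
  let ?g = "\<lambda>t. lorentz \<sigma> (light_point (\<gamma> t))"
  have g: "?g s > 0" "?g t > 0" "?g u1 < 0" "?g u2 < 0" "?g (s + 2 * pi) > 0"
    using True by (auto simp: periodic)
  have nt: "\<sigma> \<in> nontrivial_spheres K"
    using order g by (intro nontrivial_if_alternating[OF \<sigma>, of s u1 t u2]) auto
  obtain z1 z2 z3 z4 where z: "s < z1" "z1 < u1" "u1 < z2" "z2 < t" "t < z3" "z3 < u2"
      "u2 < z4" "z4 < s + 2 * pi" and z0: "?g z1 = 0" "?g z2 = 0" "?g z3 = 0" "?g z4 = 0"
    using sign_change_zero[of s u1 \<sigma>] sign_change_zero[of u1 t \<sigma>] sign_change_zero[of t u2 \<sigma>]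
      sign_change_zero[of u2 "s + 2 * pi" \<sigma>] order g by (auto simp: mult_pos_neg mult_neg_pos)
  have c4: "card {z1, z2, z3, z4} = 4"
    using z by simp
  have "of_nat (card {z1, z2, z3, z4}) \<le> intersection_number K \<sigma>"
    using z z0 by (intro card_le_intersection_number[of _ s]) auto
  then have "1 \<le> choose_two (half_intersection_number K \<sigma>)"
    unfolding half_intersection_number_def c4 by (rule choose_two_half_ge(2)) simp
  then show ?thesis
    using nt True by simp
qed simp

end

section \<open>Two close points whose arcs both go far\<close>

lemma emeasure_ball3:
  fixes c :: "real^3"
  assumes "r \<ge> 0"
  shows "emeasure lborel (ball c r) = ennreal (4 / 3 * pi * r ^ 3)"
  using assms by (simp add: emeasure_ball unit_ball_vol_3)

text \<open>
  For radius \<open>r\<close> between \<open>2 * \<epsilon>\<close> and \<open>R / 2\<close> all centers at distance less than \<open>r / 4\<close> from \<open>\<gamma> s\<close> are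
  admissible: the ball still contains \<open>\<gamma> t\<close> and still misses both far points. The centers fill a
  ball of volume \<open>(pi / 48) r ^ 3\<close>, so that the density \<open>1 / r ^ 4\<close> leaves the scale invariant
  integrand \<open>(pi / 48) / r\<close>.
\<close>

lemma (in simple_closed_curve) mnts_ge_ln:
  assumes order: "s < u1" "u1 < t" "t < u2" "u2 < s + 2 * pi"
    and near: "dist (\<gamma> s) (\<gamma> t) \<le> \<epsilon>" "0 < \<epsilon>"
    and far: "R \<le> dist (\<gamma> s) (\<gamma> u1)" "R \<le> dist (\<gamma> s) (\<gamma> u2)" and \<epsilon>R: "4 * \<epsilon> \<le> R"
  shows "ennreal (pi / 48 * ln (R / (4 * \<epsilon>))) \<le> mnts K"
proof -
  let ?S = "{\<sigma>. lorentz \<sigma> (light_point (\<gamma> s)) > 0 \<and> lorentz \<sigma> (light_point (\<gamma> t)) > 0 \<and>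
      lorentz \<sigma> (light_point (\<gamma> u1)) < 0 \<and> lorentz \<sigma> (light_point (\<gamma> u2)) < 0}"
  have "(indicator ?S :: _ \<Rightarrow> ennreal) \<in> borel_measurable borel"
    by measurable
  note ge = mnts_ge_round_spheres[OF this alternating_le_integrand[OF order]]
  define h where "h = (\<lambda>(c :: real^3, r).
      ennreal (1 / r ^ 4) * (indicator {2 * \<epsilon>..R / 2} r * indicator (ball (\<gamma> s) (r / 4)) c))"
  have [measurable]: "(\<lambda>x :: (real^3) \<times> real. indicator (ball (\<gamma> s) (snd x / 4)) (fst x) :: ennreal)
      \<in> borel_measurable (lborel \<Otimes>\<^sub>M lborel)"
    by (simp add: indicator_def)
  have [measurable]: "h \<in> borel_measurable (lborel \<Otimes>\<^sub>M lborel)"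
    unfolding h_def split_beta by measurable
  have "ennreal (pi / 48 * ln (R / (4 * \<epsilon>)))
      = ennreal (pi / 48 * ln (R / 2) - pi / 48 * ln (2 * \<epsilon>))"
    using near \<epsilon>R ln_div[of "R / 2" "2 * \<epsilon>"] by (simp add: right_diff_distrib[symmetric])
  also have "\<dots> = (\<integral>\<^sup>+ r. ennreal (pi / 48 / r) * indicator {2 * \<epsilon>..R / 2} r \<partial>lborel)"
  proof (rule nn_integral_FTC_Icc[symmetric])
    fix r assume "r \<in> {2 * \<epsilon>..R / 2}"
    then have "r > 0"
      using near by simp
    then show "((\<lambda>r. pi / 48 * ln r) has_real_derivative pi / 48 / r) (at r)" "0 \<le> pi / 48 / r"
      by (auto intro!: derivative_eq_intros)
  qed (use near \<epsilon>R in auto)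
  also have "\<dots> = (\<integral>\<^sup>+ r. \<integral>\<^sup>+ c. h (c, r) \<partial>lborel \<partial>lborel)"
  proof (rule nn_integral_cong)
    fix r :: real
    show "ennreal (pi / 48 / r) * indicator {2 * \<epsilon>..R / 2} r = (\<integral>\<^sup>+ c. h (c, r) \<partial>lborel)"
    proof (cases "r \<in> {2 * \<epsilon>..R / 2}")
      case True
      then have r: "r > 0"
        using near by simp
      have "(\<integral>\<^sup>+ c. h (c, r) \<partial>lborel) = ennreal (1 / r ^ 4) * emeasure lborel (ball (\<gamma> s) (r / 4))"
        using True by (simp add: h_def nn_integral_cmult_indicator)
      also have "\<dots> = ennreal (pi / 48 / r)"
        using r by (simp add: emeasure_ball3 ennreal_mult[symmetric] field_simps power_divide eval_nat_numeral)
      finally show ?thesis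
        using True by simp
    qed (simp add: h_def)
  qed
  also have "\<dots> = (\<integral>\<^sup>+ x. h x \<partial>lborel)"
    by (subst lborel_prod[symmetric], rule lborel_pair.nn_integral_snd) measurable
  also have "\<dots> \<le> (\<integral>\<^sup>+ (c, r). ennreal (1 / r ^ 4) * indicator ?S (round_sphere 1 c r) * indicator {0<..} r \<partial>lborel)"
  proof (rule nn_integral_mono)
    fix x :: "(real^3) \<times> real"
    obtain c r where x: "x = (c, r)"
      by (cases x) auto
    have "h (c, r) \<le> ennreal (1 / r ^ 4) * indicator ?S (round_sphere 1 c r) * indicator {0<..} r"
    proof (cases "r \<in> {2 * \<epsilon>..R / 2} \<and> c \<in> ball (\<gamma> s) (r / 4)")
      case True
      then have r: "r > 0" "2 * \<epsilon> \<le> r" "r \<le> R / 2" and c: "dist (\<gamma> s) c < r / 4"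
        using near by auto
      have "dist (\<gamma> t) c < r"
        using dist_triangle[of "\<gamma> t" c "\<gamma> s"] near c r by (simp add: dist_commute)
      moreover have "r < dist (\<gamma> u1) c" "r < dist (\<gamma> u2) c"
        using dist_triangle[of "\<gamma> s" "\<gamma> u1" c] dist_triangle[of "\<gamma> s" "\<gamma> u2" c] far c r
        by (simp_all add: dist_commute)
      ultimately have "round_sphere 1 c r \<in> ?S"
        using r c by (simp add: lorentz_round_sphere_pos_iff lorentz_round_sphere_neg_iff)
      then show ?thesis
        using r True by (simp add: h_def)
    qed (auto simp: h_def)
    then show "h x \<le> (case x of (c, r) \<Rightarrow>
        ennreal (1 / r ^ 4) * indicator ?S (round_sphere 1 c r) * indicator {0<..} r)"
      by (simp add: x)
  qed
  also have "\<dots> \<le> mnts K"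
    by (rule ge)
  finally show ?thesis .
qed

section \<open>Inscribed polygons\<close>

text \<open>
  Both the arc and the chord differ by at most \<open>e * (b - a)\<close> from the length of the tangent vector
  \<open>(b - a) *\<^sub>R \<gamma>' a\<close>.
\<close>

lemma integral_norm_le_chord:
  fixes \<gamma> :: "real \<Rightarrow> 'a::euclidean_space"
  assumes "a \<le> b" and deriv: "\<And>t. (\<gamma> has_vector_derivative \<gamma>' t) (at t)"
    and cont: "continuous_on UNIV \<gamma>'" and e: "\<And>t. t \<in> {a..b} \<Longrightarrow> norm (\<gamma>' t - \<gamma>' a) \<le> e"
  shows "integral {a..b} (\<lambda>t. norm (\<gamma>' t)) \<le> dist (\<gamma> a) (\<gamma> b) + 2 * e * (b - a)"
proof -
  have "e \<ge> 0"
    using e[of a] assms(1) by simp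
  have "(\<gamma>' has_integral \<gamma> b - \<gamma> a) {a..b}"
    using assms(1) deriv by (intro fundamental_theorem_of_calculus) (auto intro: has_vector_derivative_at_within)
  moreover have "((\<lambda>_. \<gamma>' a) has_integral (b - a) *\<^sub>R \<gamma>' a) {a..b}"
    using has_integral_const_real[of "\<gamma>' a" a b] assms(1) by simp
  ultimately have "((\<lambda>t. \<gamma>' t - \<gamma>' a) has_integral (\<gamma> b - \<gamma> a) - (b - a) *\<^sub>R \<gamma>' a) {a..b}"
    by (rule has_integral_diff)
  then have "norm ((\<gamma> b - \<gamma> a) - (b - a) *\<^sub>R \<gamma>' a) \<le> e * measure lborel {a..b}"
    by (rule has_integral_bound_real[OF \<open>e \<ge> 0\<close> finite.emptyI]) (use e in auto)
  then have "norm ((\<gamma> b - \<gamma> a) - (b - a) *\<^sub>R \<gamma>' a) \<le> e * (b - a)"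
    using assms(1) by simp
  then have "norm ((b - a) *\<^sub>R \<gamma>' a) \<le> dist (\<gamma> a) (\<gamma> b) + e * (b - a)"
    using norm_triangle_sub[of "(b - a) *\<^sub>R \<gamma>' a" "\<gamma> b - \<gamma> a"]
    by (simp add: dist_norm norm_minus_commute)
  moreover have "integral {a..b} (\<lambda>t. norm (\<gamma>' t)) \<le> integral {a..b} (\<lambda>t. norm (\<gamma>' a) + e)"
  proof (rule integral_le)
    show "(\<lambda>t. norm (\<gamma>' t)) integrable_on {a..b}"
      by (intro integrable_continuous_real continuous_intros continuous_on_subset[OF cont] subset_UNIV)
    show "norm (\<gamma>' t) \<le> norm (\<gamma>' a) + e" if "t \<in> {a..b}" for t
      using e[OF that] norm_triangle_sub[of "\<gamma>' t" "\<gamma>' a"] by simp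
  qed (intro integrable_continuous_real continuous_intros)
  moreover have "integral {a..b} (\<lambda>t. norm (\<gamma>' a) + e) = norm ((b - a) *\<^sub>R \<gamma>' a) + e * (b - a)"
    using assms(1) by (simp add: distrib_left mult.commute[of e])
  ultimately show ?thesis
    by simp
qed

text \<open>
  By uniform continuity of \<open>\<gamma>'\<close> the total error of the chords of a sufficiently fine partition is at
  most half of the length.
\<close>

lemma inscribed_polygon:
  fixes \<gamma> :: "real \<Rightarrow> 'a::euclidean_space"
  assumes deriv: "\<And>t. (\<gamma> has_vector_derivative \<gamma>' t) (at t)" and cont: "continuous_on UNIV \<gamma>'"
    and "a < b" "0 < \<eta>" and pos: "0 < integral {a..b} (\<lambda>t. norm (\<gamma>' t))"
  obtains \<tau> :: "nat \<Rightarrow> real" and N where "strict_mono \<tau>" "\<tau> 0 = a" "\<tau> N = b"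
    "\<And>i. i < N \<Longrightarrow> dist (\<gamma> (\<tau> i)) (\<gamma> (\<tau> (Suc i))) \<le> \<eta>"
    "integral {a..b} (\<lambda>t. norm (\<gamma>' t)) / 2 \<le> (\<Sum>i<N. dist (\<gamma> (\<tau> i)) (\<gamma> (\<tau> (Suc i))))"
proof -
  let ?L = "integral {a..b} (\<lambda>t. norm (\<gamma>' t))"
  \<comment> \<open>The oscillation \<open>e\<close> is a quarter of the mean speed \<open>w\<close>, so that the total error \<open>2 * e * (b - a)\<close>
    is half of the length.\<close>
  define w where "w = ?L / (b - a)"
  define e where "e = w / 4"
  have "w * (b - a) = ?L" "w > 0"
    using pos \<open>a < b\<close> by (simp_all add: w_def)
  then have e: "e > 0" "2 * e * (b - a) = ?L / 2"
    by (simp_all add: e_def)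
  have "continuous_on UNIV \<gamma>"
    using deriv by (meson continuous_at_imp_continuous_on has_vector_derivative_continuous)
  then have "uniformly_continuous_on {a..b} \<gamma>" "uniformly_continuous_on {a..b} \<gamma>'"
    using cont by (auto intro!: compact_uniformly_continuous intro: continuous_on_subset)
  note uc = this[unfolded uniformly_continuous_on_def, rule_format]
  obtain d1 where d1: "d1 > 0"
      "\<And>u v. u \<in> {a..b} \<Longrightarrow> v \<in> {a..b} \<Longrightarrow> dist v u < d1 \<Longrightarrow> dist (\<gamma> v) (\<gamma> u) < \<eta>"
    using uc(1)[OF \<open>0 < \<eta>\<close>] by auto
  obtain d2 where d2: "d2 > 0"
      "\<And>u v. u \<in> {a..b} \<Longrightarrow> v \<in> {a..b} \<Longrightarrow> dist v u < d2 \<Longrightarrow> dist (\<gamma>' v) (\<gamma>' u) < e"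
    using uc(2)[OF e(1)] by auto
  define d where "d = min d1 d2"
  have d: "0 < d" "d \<le> d1" "d \<le> d2"
    using d1(1) d2(1) by (auto simp: d_def)
  obtain N :: nat where N: "(b - a) / d < N"
    using reals_Archimedean2 by blast
  moreover have "0 < (b - a) / d"
    using d \<open>a < b\<close> by simp
  ultimately have N0: "0 < real N"
    by linarith
  define h where "h = (b - a) / N"
  have "h < d" "0 < h" "N * h = b - a"
    using N N0 d(1) \<open>a < b\<close> by (auto simp: h_def field_simps)
  then have h: "0 < h" "h < d1" "h < d2" "N * h = b - a"
    using d by auto
  define \<tau> where "\<tau> i = a + real i * h" for i :: nat
  have \<tau>_mono: "strict_mono \<tau>"
    using h by (auto simp: strict_mono_def \<tau>_def)
  have \<tau>_ends: "\<tau> 0 = a" "\<tau> N = b"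
    using h by (auto simp: \<tau>_def)
  have \<tau>_Suc: "\<tau> (Suc i) = \<tau> i + h" for i
    by (simp add: \<tau>_def algebra_simps)
  have \<tau>_in: "\<tau> i \<in> {a..b}" if "i \<le> N" for i
    using strict_mono_less_eq[OF \<tau>_mono, of 0 i] strict_mono_less_eq[OF \<tau>_mono, of i N] that \<tau>_ends
    by auto
  have int: "(\<lambda>t. norm (\<gamma>' t)) integrable_on {u..v}" for u v
    by (intro integrable_continuous_real continuous_intros continuous_on_subset[OF cont] subset_UNIV)
  have step: "integral {\<tau> i..\<tau> (Suc i)} (\<lambda>t. norm (\<gamma>' t))
      \<le> dist (\<gamma> (\<tau> i)) (\<gamma> (\<tau> (Suc i))) + 2 * e * h" if "i < N" for i
  proof -
    have "norm (\<gamma>' t - \<gamma>' (\<tau> i)) \<le> e" if t: "t \<in> {\<tau> i..\<tau> (Suc i)}" for t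
    proof -
      have "t \<in> {a..b}" "dist t (\<tau> i) < d2"
        using t \<tau>_in[of i] \<tau>_in[of "Suc i"] \<open>i < N\<close> \<tau>_Suc[of i] h by (auto simp: dist_real_def)
      then show ?thesis
        using d2(2)[of "\<tau> i" t] \<tau>_in[of i] \<open>i < N\<close> by (simp add: dist_norm)
    qed
    then show ?thesis
      using integral_norm_le_chord[of "\<tau> i" "\<tau> (Suc i)" \<gamma> \<gamma>' e, OF _ deriv cont] \<tau>_Suc[of i] h by simp
  qed
  have "integral {a..\<tau> k} (\<lambda>t. norm (\<gamma>' t))
      \<le> (\<Sum>i<k. dist (\<gamma> (\<tau> i)) (\<gamma> (\<tau> (Suc i)))) + k * (2 * e * h)" if "k \<le> N" for k
    using that
  proof (induction k)
    case (Suc k)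
    have "integral {a..\<tau> (Suc k)} (\<lambda>t. norm (\<gamma>' t))
        = integral {a..\<tau> k} (\<lambda>t. norm (\<gamma>' t)) + integral {\<tau> k..\<tau> (Suc k)} (\<lambda>t. norm (\<gamma>' t))"
      using \<tau>_in[of k] Suc.prems \<tau>_Suc[of k] h int
      by (intro Henstock_Kurzweil_Integration.integral_combine[symmetric]) auto
    then show ?case
      using Suc step[of k] by (simp add: algebra_simps)
  qed (simp add: \<tau>_ends)
  from this[of N] have "?L \<le> (\<Sum>i<N. dist (\<gamma> (\<tau> i)) (\<gamma> (\<tau> (Suc i)))) + 2 * e * (b - a)"
    using \<tau>_ends unfolding h(4)[symmetric] by (simp add: mult_ac)
  then have "?L / 2 \<le> (\<Sum>i<N. dist (\<gamma> (\<tau> i)) (\<gamma> (\<tau> (Suc i))))"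
    unfolding e(2) by simp
  moreover have "dist (\<gamma> (\<tau> i)) (\<gamma> (\<tau> (Suc i))) \<le> \<eta>" if "i < N" for i
    using d1(2)[of "\<tau> (Suc i)" "\<tau> i"] \<tau>_in[of i] \<tau>_in[of "Suc i"] that \<tau>_Suc[of i] h
    by (simp add: dist_real_def)
  ultimately show thesis
    by (intro that[OF \<tau>_mono \<tau>_ends])
qed

section \<open>Long arcs in small balls\<close>

text \<open>
  Seen from a center \<open>c\<close> that lies behind \<open>p\<close>, opposite to the direction \<open>u\<close> from \<open>p\<close> to \<open>q\<close>, the point
  \<open>q\<close> is farther away than \<open>p\<close> by a fixed fraction of \<open>dist p q\<close>. The difference is read off from the
  difference of the squared distances, which is \<open>2 * dist p q * (u \<bullet> (p - c)) + (dist p q)\<^sup>2\<close>.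
\<close>

lemma dist_gain_behind:
  fixes p q c u :: "'a::euclidean_space"
  assumes R: "0 < R" and d: "dist p q \<le> R / 10" and u: "norm u = 1" "q - p = dist p q *\<^sub>R u"
    and c: "c \<in> ball (p - (3 / 2 * R) *\<^sub>R u) (R / 10)"
  shows "R \<le> dist p c" "dist q c \<le> 2 * R" "dist p q / 2 \<le> dist q c - dist p c"
proof -
  define w where "w = c - (p - (3 / 2 * R) *\<^sub>R u)"
  have w: "norm w < R / 10"
    using c by (simp add: w_def dist_norm norm_minus_commute)
  have pc: "p - c = (3 / 2 * R) *\<^sub>R u - w"
    by (simp add: w_def)
  have qc: "q - c = (p - c) + dist p q *\<^sub>R u"
    using u(2) by (simp add: algebra_simps)
  have n: "norm ((3 / 2 * R) *\<^sub>R u) = 3 / 2 * R"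
    using u R by simp
  have A: "dist p c \<ge> 7 / 5 * R" "dist p c \<le> 8 / 5 * R"
    unfolding dist_norm pc
    using norm_triangle_ineq2[of "(3 / 2 * R) *\<^sub>R u" w] norm_triangle_ineq4[of "(3 / 2 * R) *\<^sub>R u" w] n w R
    by simp_all
  have B: "dist q c \<le> dist p c + dist p q"
    using dist_triangle[of q c p] by (simp add: dist_commute)
  show "R \<le> dist p c" "dist q c \<le> 2 * R"
    using A B d R by simp_all
  have "u \<bullet> w \<le> R / 10"
    using Cauchy_Schwarz_ineq2[of u w] u w by simp
  then have "u \<bullet> (p - c) \<ge> 7 / 5 * R"
    using u(1) R by (simp add: pc inner_diff_right norm_eq_1)
  then have "dist p q * (u \<bullet> (p - c)) \<ge> dist p q * (7 / 5 * R)"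
    by (intro mult_left_mono) auto
  moreover have "(dist q c)\<^sup>2 = (dist p c)\<^sup>2 + 2 * (dist p q * (u \<bullet> (p - c))) + (dist p q)\<^sup>2"
    using u(1) unfolding dist_norm[of q c] dist_norm[of p c] qc power2_norm_eq_inner
    by (simp add: inner_add_left inner_add_right inner_commute norm_eq_1 power2_eq_square)
  moreover have "(dist q c - dist p c) * (dist q c + dist p c) = (dist q c)\<^sup>2 - (dist p c)\<^sup>2"
    by (simp add: algebra_simps power2_eq_square)
  ultimately have ge: "(dist q c - dist p c) * (dist q c + dist p c) \<ge> 14 / 5 * (R * dist p q)"
    using zero_le_power2[of "dist p q"] by argo
  show "dist p q / 2 \<le> dist q c - dist p c"
  proof (rule ccontr)
    assume less: "\<not> dist p q / 2 \<le> dist q c - dist p c"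
    have "(dist q c - dist p c) * (dist q c + dist p c) \<le> dist p q / 2 * (dist q c + dist p c)"
      using less by (intro mult_right_mono) auto
    also have "\<dots> \<le> dist p q / 2 * (7 / 2 * R)"
      using A B d by (intro mult_left_mono) auto
    finally have "R * dist p q \<le> 0"
      using ge zero_le_dist[of p q] by argo
    then have "dist p q = 0"
      using R by (simp add: mult_le_0_iff)
    then show False
      using less u(2) by simp
  qed
qed

text \<open>
  The volume in the coordinates (center, radius) is estimated by integrating over the radius first:
  for a center \<open>c\<close> as in \<open>dist_gain_behind\<close> the admissible radii form an interval of length
  \<open>dist q c - dist p c\<close>.
\<close>

lemma emeasure_separating_balls:
  fixes p q :: "real^3"
  assumes R: "0 < R" and d: "dist p q \<le> R / 10"
  shows "ennreal (dist p q / 2 * (4 / 3 * pi * (R / 10) ^ 3))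
    \<le> emeasure lborel {(c, r). R \<le> r \<and> r \<le> 2 * R \<and> dist p c < r \<and> r < dist q c}"
proof (cases "p = q")
  case False
  let ?S = "{(c, r). R \<le> r \<and> r \<le> 2 * R \<and> dist p c < r \<and> r < dist q c}"
  define u where "u = (1 / dist p q) *\<^sub>R (q - p)"
  have u: "norm u = 1" "q - p = dist p q *\<^sub>R u"
    using False by (auto simp: u_def dist_norm norm_minus_commute)
  define B where "B = ball (p - (3 / 2 * R) *\<^sub>R u) (R / 10)"
  have S: "?S \<in> sets (lborel \<Otimes>\<^sub>M lborel)"
  proof -
    have "?S = {x \<in> space (lborel \<Otimes>\<^sub>M lborel). R \<le> snd x \<and> snd x \<le> 2 * R \<and>
        dist p (fst x) < snd x \<and> snd x < dist q (fst x)}"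
      by (auto simp: space_pair_measure)
    also have "\<dots> \<in> sets (lborel \<Otimes>\<^sub>M lborel)"
      by measurable
    finally show ?thesis .
  qed
  have "ennreal (dist p q / 2 * (4 / 3 * pi * (R / 10) ^ 3))
      = (\<integral>\<^sup>+ c. ennreal (dist p q / 2) * indicator B c \<partial>lborel)"
    using R by (subst nn_integral_cmult_indicator) (simp_all add: B_def emeasure_ball3 ennreal_mult[symmetric] algebra_simps)
  also have "\<dots> \<le> (\<integral>\<^sup>+ c. emeasure lborel (Pair c -` ?S) \<partial>lborel)"
  proof (rule nn_integral_mono)
    fix c
    show "ennreal (dist p q / 2) * indicator B c \<le> emeasure lborel (Pair c -` ?S)"
    proof (cases "c \<in> B")
      case True
      note gain = dist_gain_behind[OF R d u True[unfolded B_def]]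
      have le: "dist p c \<le> dist q c"
        using gain(3) zero_le_dist[of p q] by linarith
      have "ennreal (dist p q / 2) \<le> ennreal (dist q c - dist p c)"
        using gain by (intro ennreal_leI)
      also have "\<dots> = emeasure lborel {dist p c<..<dist q c}"
        using le by simp
      also have "\<dots> \<le> emeasure lborel (Pair c -` ?S)"
        using gain sets_Pair1[OF S, of c] by (intro emeasure_mono) auto
      finally show ?thesis
        using True by simp
    qed simp
  qed
  also have "\<dots> = emeasure (lborel \<Otimes>\<^sub>M lborel) ?S"
    by (rule lborel.emeasure_pair_measure_alt[OF S, symmetric])
  finally show ?thesis
    by (simp add: lborel_prod)
qed simp

text \<open>
  The number of inside-outside steps along a fine polygon is integrated over the radii in \<open>{R..2 * R}\<close>.
  Centers outside \<open>ball x (3 * R)\<close> contribute nothing, so the constant 2 subtracted from half of the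
  count costs only a multiple of the volume \<open>36 pi R ^ 4\<close> of \<open>Q\<close>. On \<open>Q\<close> the density is at least
  \<open>1 / (16 R ^ 4)\<close>; it is put in at the end.
\<close>

lemma (in simple_closed_curve) mnts_ge_length:
  assumes deriv: "\<And>t. (\<gamma> has_vector_derivative \<gamma>' t) (at t)" and cont': "continuous_on UNIV \<gamma>'"
    and ab: "a < b" "b \<le> a + 2 * pi" and R: "0 < R" and inside: "\<gamma> ` {a..b} \<subseteq> cball x R"
    and L: "L \<le> integral {a..b} (\<lambda>t. norm (\<gamma>' t))" "0 < L"
  shows "ennreal (pi / 12 * (L / (8000 * R) - 54)) \<le> mnts K"
proof -
  obtain \<tau> :: "nat \<Rightarrow> real" and N where \<tau>: "strict_mono \<tau>" "\<tau> 0 = a" "\<tau> N = b"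
    and small: "\<And>i. i < N \<Longrightarrow> dist (\<gamma> (\<tau> i)) (\<gamma> (\<tau> (Suc i))) \<le> R / 10"
    and long: "integral {a..b} (\<lambda>t. norm (\<gamma>' t)) / 2 \<le> (\<Sum>i<N. dist (\<gamma> (\<tau> i)) (\<gamma> (\<tau> (Suc i))))"
    using inscribed_polygon[OF deriv cont' ab(1), of "R / 10"] R L by auto
  define p where "p i = \<gamma> (\<tau> i)" for i
  have p_in: "dist x (p i) \<le> R" if "i \<le> N" for i
  proof -
    have "\<tau> i \<in> {a..b}"
      using strict_mono_less_eq[OF \<tau>(1), of 0 i] strict_mono_less_eq[OF \<tau>(1), of i N] that \<tau> by auto
    then show ?thesis
      using inside unfolding p_def by (meson image_subset_iff mem_cball)
  qed
  define G where "G \<sigma> = ennreal (crossing_count p N \<sigma> / 2 - 2)" for \<sigma>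
  have "G \<in> borel_measurable borel"
    unfolding G_def by measurable
  moreover have "G \<sigma> \<le> choose_two (half_intersection_number K \<sigma>) * indicator (nontrivial_spheres K) \<sigma>"
    if "\<sigma> \<in> Lambda" for \<sigma>
    unfolding G_def p_def using crossing_count_le_integrand[OF \<tau>(1) _ _ that, of a N] \<tau> ab by simp
  ultimately have ge: "(\<integral>\<^sup>+ (c, r). ennreal (1 / r ^ 4) * G (round_sphere 1 c r) * indicator {0<..} r \<partial>lborel) \<le> mnts K"
    by (rule mnts_ge_round_spheres)
  define Q where "Q = ball x (3 * R) \<times> {R..2 * R}"
  have Q: "Q \<in> sets borel"
    unfolding Q_def borel_prod[symmetric] by simp
  have vol_Q: "emeasure lborel Q = ennreal (36 * pi * R ^ 4)"
    using R unfolding Q_def lborel_prod[symmetric]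
    by (simp add: lborel.emeasure_pair_measure_Times emeasure_ball3 ennreal_mult[symmetric]
        power_mult_distrib eval_nat_numeral)
  define S where "S i = {(c, r). R \<le> r \<and> r \<le> 2 * R \<and> dist (p i) c < r \<and> r < dist (p (Suc i)) c}" for i
  have S[measurable]: "S i \<in> sets borel" for i
  proof -
    have "S i = {x \<in> space (borel \<Otimes>\<^sub>M borel). R \<le> snd x \<and> snd x \<le> 2 * R \<and>
        dist (p i) (fst x) < snd x \<and> snd x < dist (p (Suc i)) (fst x)}"
      by (auto simp: space_pair_measure S_def)
    also have "\<dots> \<in> sets (borel \<Otimes>\<^sub>M borel)"
      by measurable
    finally show ?thesis
      unfolding borel_prod .
  qed
  have S_sub: "S i \<subseteq> Q" if "i < N" for i
  proof
    fix y assume "y \<in> S i"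
    then obtain c r where y: "y = (c, r)" "R \<le> r" "r \<le> 2 * R" "dist (p i) c < r"
      by (auto simp: S_def)
    then show "y \<in> Q"
      using dist_triangle[of x c "p i"] p_in[of i] that by (auto simp: Q_def)
  qed
  have [measurable]: "(\<lambda>x. G (round_sphere 1 (fst x) (snd x))) \<in> borel_measurable borel"
  proof -
    have "(\<lambda>x :: (real^3) \<times> real. round_sphere 1 (fst x) (snd x)) \<in> borel_measurable borel"
      unfolding round_sphere_def borel_prod[symmetric] scaleR_Pair
      by (intro measurable_Pair) measurable
    then show ?thesis
      unfolding G_def by (rule measurable_compose) measurable
  qed
  let ?J = "\<integral>\<^sup>+ y. G (round_sphere 1 (fst y) (snd y)) * indicator Q y \<partial>lborel"
  \<comment> \<open>The subtracted constant is moved to the right-hand side, since subtraction truncates in \<open>ennreal\<close>.\<close>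
  have count: "(\<Sum>i<N. ennreal (1 / 2) * indicator (S i) y)
      \<le> G (round_sphere 1 (fst y) (snd y)) * indicator Q y + 2 * indicator Q y" for y
  proof (cases "y \<in> Q")
    case True
    obtain c r where y: "y = (c, r)" by (cases y) auto
    then have r: "R \<le> r" "r \<le> 2 * R" "r > 0"
      using True R by (auto simp: Q_def)
    have "(\<Sum>i<N. ennreal (1 / 2) * indicator (S i) y) = (\<Sum>i<N. ennreal (1 / 2 * indicator (S i) y))"
      by (intro sum.cong refl) (simp add: indicator_def)
    also have "\<dots> = ennreal (\<Sum>i<N. 1 / 2 * indicator (S i) y)"
      by (rule sum_ennreal) simp
    also have "(\<Sum>i<N. 1 / 2 * indicator (S i) y) = crossing_count p N (round_sphere 1 c r) / (2::real)"
      unfolding crossing_count_eq_sum sum_divide_distrib using r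
      by (intro sum.cong refl)
        (simp add: indicator_def S_def y lorentz_round_sphere_pos_iff lorentz_round_sphere_neg_iff)
    also have "ennreal \<dots> \<le> G (round_sphere 1 c r) + ennreal 2"
      unfolding G_def by (cases "crossing_count p N (round_sphere 1 c r) / (2::real) \<ge> 2")
        (simp_all add: ennreal_plus[symmetric] ennreal_neg ennreal_leI del: ennreal_plus ennreal_numeral)
    finally show ?thesis
      using True y by simp
  next
    case False
    then have "y \<notin> S i" if "i < N" for i
      using S_sub[OF that] by blast
    then show ?thesis by simp
  qed
  have "ennreal (pi / 6000 * R ^ 3 * L)
      \<le> ennreal (\<Sum>i<N. 1 / 2 * (dist (p i) (p (Suc i)) / 2 * (4 / 3 * pi * (R / 10) ^ 3)))"
  proof (rule ennreal_leI)
    have "L / 2 \<le> (\<Sum>i<N. dist (p i) (p (Suc i)))"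
      using long L by (simp add: p_def)
    then have "pi / 3000 * R ^ 3 * (L / 2) \<le> pi / 3000 * R ^ 3 * (\<Sum>i<N. dist (p i) (p (Suc i)))"
      using R by (intro mult_left_mono) auto
    also have "\<dots> = (\<Sum>i<N. 1 / 2 * (dist (p i) (p (Suc i)) / 2 * (4 / 3 * pi * (R / 10) ^ 3)))"
      by (simp add: sum_distrib_left power_divide mult_ac)
    finally show "pi / 6000 * R ^ 3 * L
        \<le> (\<Sum>i<N. 1 / 2 * (dist (p i) (p (Suc i)) / 2 * (4 / 3 * pi * (R / 10) ^ 3)))"
      by simp
  qed
  also have "\<dots> = (\<Sum>i<N. ennreal (1 / 2) * ennreal (dist (p i) (p (Suc i)) / 2 * (4 / 3 * pi * (R / 10) ^ 3)))"
    using R by (subst sum_ennreal[symmetric]) (auto simp: ennreal_mult[symmetric] simp del: ennreal_half)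
  also have "\<dots> \<le> (\<Sum>i<N. ennreal (1 / 2) * emeasure lborel (S i))"
    using small unfolding S_def p_def
    by (intro sum_mono mult_left_mono emeasure_separating_balls R) auto
  also have "\<dots> = (\<integral>\<^sup>+ y. (\<Sum>i<N. ennreal (1 / 2) * indicator (S i) y) \<partial>lborel)"
    by (subst nn_integral_sum) (auto simp: nn_integral_cmult simp del: ennreal_half)
  also have "\<dots> \<le> (\<integral>\<^sup>+ y. G (round_sphere 1 (fst y) (snd y)) * indicator Q y + 2 * indicator Q y \<partial>lborel)"
    by (intro nn_integral_mono count)
  also have "\<dots> = ?J + 2 * emeasure lborel Q"
    using Q by (subst nn_integral_add) (auto simp: nn_integral_cmult)
  also have "\<dots> = ?J + ennreal (72 * pi * R ^ 4)"
  proof -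
    have "2 * ennreal (36 * pi * R ^ 4) = ennreal (2 * (36 * pi * R ^ 4))"
      using R by (subst ennreal_mult) auto
    then show ?thesis
      by (simp add: vol_Q)
  qed
  finally have "ennreal (pi / 6000 * R ^ 3 * L) - ennreal (72 * pi * R ^ 4) \<le> ?J"
    by (simp add: ennreal_minus_le_iff add.commute)
  then have J: "ennreal (pi / 6000 * R ^ 3 * L - 72 * pi * R ^ 4) \<le> ?J"
    using R by (simp add: ennreal_minus)
  have "ennreal (pi / 12 * (L / (8000 * R) - 54))
      = ennreal (1 / (16 * R ^ 4)) * ennreal (pi / 6000 * R ^ 3 * L - 72 * pi * R ^ 4)"
  proof -
    have "pi / 12 * (L / (8000 * R) - 54) = 1 / (16 * R ^ 4) * (pi / 6000 * R ^ 3 * L - 72 * pi * R ^ 4)"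
      using R by (simp add: right_diff_distrib eval_nat_numeral)
    then show ?thesis
      using R by (simp add: ennreal_mult' del: times_divide_eq_left)
  qed
  also have "\<dots> \<le> ennreal (1 / (16 * R ^ 4)) * ?J"
    by (intro mult_left_mono J) simp
  also have "\<dots> = (\<integral>\<^sup>+ y. ennreal (1 / (16 * R ^ 4)) * (G (round_sphere 1 (fst y) (snd y)) * indicator Q y) \<partial>lborel)"
    using Q by (intro nn_integral_cmult[symmetric]) simp
  also have "\<dots> \<le> (\<integral>\<^sup>+ (c, r). ennreal (1 / r ^ 4) * G (round_sphere 1 c r) * indicator {0<..} r \<partial>lborel)"
  proof (rule nn_integral_mono)
    fix y :: "(real^3) \<times> real"
    obtain c r where y: "y = (c, r)"
      by (cases y) auto
    have "1 / (16 * R ^ 4) \<le> 1 / r ^ 4" "r > 0" if "(c, r) \<in> Q"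
    proof -
      show r: "r > 0"
        using that R by (auto simp: Q_def)
      have "r ^ 4 \<le> (2 * R) ^ 4"
        using that r by (intro power_mono) (auto simp: Q_def)
      then show "1 / (16 * R ^ 4) \<le> 1 / r ^ 4"
        using r R by (intro divide_left_mono) (auto simp: power_mult_distrib)
    qed
    then show "ennreal (1 / (16 * R ^ 4)) * (G (round_sphere 1 (fst y) (snd y)) * indicator Q y)
        \<le> (case y of (c, r) \<Rightarrow> ennreal (1 / r ^ 4) * G (round_sphere 1 c r) * indicator {0<..} r)"
      by (cases "(c, r) \<in> Q") (auto simp: y intro!: mult_right_mono ennreal_leI)
  qed
  also have "\<dots> \<le> mnts K"
    by (rule ge)
  finally show ?thesis .
qed

section \<open>The energy property\<close>

text \<open>
  The second arc from \<open>\<gamma> s\<close> to \<open>\<gamma> t\<close> is split at the base point of the parametrization. When it stays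
  in the ball, one of the two pieces has at least half of its length; this is why the arcs are
  required to have length at least \<open>2 * L\<close>.
\<close>

lemma (in simple_closed_curve) mnts_ge_of_close_pair:
  assumes deriv: "\<And>t. (\<gamma> has_vector_derivative \<gamma>' t) (at t)" and cont': "continuous_on UNIV \<gamma>'"
    and st: "0 \<le> s" "s \<le> t" "t \<le> 2 * pi"
    and arc1: "2 * L \<le> integral {s..t} (\<lambda>u. norm (\<gamma>' u))"
    and arc2: "2 * L \<le> integral {0..s} (\<lambda>u. norm (\<gamma>' u)) + integral {t..2 * pi} (\<lambda>u. norm (\<gamma>' u))"
    and L: "0 < L" and near: "dist (\<gamma> s) (\<gamma> t) \<le> \<epsilon>" "0 < \<epsilon>" "4 * \<epsilon> \<le> R"
  shows "min (ennreal (pi / 12 * (L / (8000 * R) - 54))) (ennreal (pi / 48 * ln (R / (4 * \<epsilon>)))) \<le> mnts K"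
proof -
  have R: "0 < R"
    using near by linarith
  have long: ?thesis
    if "a < b" "b \<le> a + 2 * pi" "L \<le> integral {a..b} (\<lambda>u. norm (\<gamma>' u))"
      "\<And>u. u \<in> {a..b} \<Longrightarrow> dist (\<gamma> s) (\<gamma> u) \<le> R" for a b
  proof -
    have "\<gamma> ` {a..b} \<subseteq> cball (\<gamma> s) R"
      using that(4) by (simp add: image_subset_iff)
    from mnts_ge_length[OF deriv cont' that(1,2) R this that(3) L] show ?thesis
      by (rule min.coboundedI1)
  qed
  have less: "a < b" if "L \<le> integral {a..b} (\<lambda>u. norm (\<gamma>' u))" for a b
    using that L by (cases "a < b") (auto simp: integral_empty not_less le_less)
  consider (arc1) "\<And>u. u \<in> {s..t} \<Longrightarrow> dist (\<gamma> s) (\<gamma> u) \<le> R"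
    | (arc2) "\<And>u. u \<in> {0..s} \<union> {t..2 * pi} \<Longrightarrow> dist (\<gamma> s) (\<gamma> u) \<le> R"
    | (far) u1 u2 where "u1 \<in> {s..t}" "u2 \<in> {0..s} \<union> {t..2 * pi}"
        "R < dist (\<gamma> s) (\<gamma> u1)" "R < dist (\<gamma> s) (\<gamma> u2)"
    using not_less by blast
  then show ?thesis
  proof cases
    case arc1
    have "L \<le> integral {s..t} (\<lambda>u. norm (\<gamma>' u))"
      using assms(6) L by linarith
    then show ?thesis
      using st arc1 by (intro long[of s t] less) auto
  next
    case arc2
    consider "L \<le> integral {0..s} (\<lambda>u. norm (\<gamma>' u))" | "L \<le> integral {t..2 * pi} (\<lambda>u. norm (\<gamma>' u))"
      using assms(7) by linarith
    then show ?thesis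
    proof cases
      case 1
      then show ?thesis
        using st arc2 by (intro long[of 0 s] less) auto
    next
      case 2
      then show ?thesis
        using st arc2 by (intro long[of t "2 * pi"] less) auto
    qed
  next
    case far
    have ne: "\<gamma> u1 \<noteq> \<gamma> s" "\<gamma> u1 \<noteq> \<gamma> t" "\<gamma> u2 \<noteq> \<gamma> s" "\<gamma> u2 \<noteq> \<gamma> t"
      using far near R by auto
    have per: "\<gamma> (2 * pi) = \<gamma> 0"
      using periodic[of 0] by simp
    \<comment> \<open>The exit point on the second arc is moved by a period, if necessary, to follow \<open>t\<close>.\<close>
    obtain u3 where u3: "t < u3" "u3 < s + 2 * pi" "\<gamma> u3 = \<gamma> u2"
    proof (cases "u2 \<in> {0..s}")
      case True
      show thesis
      proof (rule that)
        show "\<gamma> (u2 + 2 * pi) = \<gamma> u2"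
          by (rule periodic)
        have "u2 \<noteq> 0 \<or> t \<noteq> 2 * pi" "u2 \<noteq> s"
          using ne per by auto
        then show "t < u2 + 2 * pi" "u2 + 2 * pi < s + 2 * pi"
          using True st by auto
      qed
    next
      case False
      show thesis
      proof (rule that)
        have "u2 \<noteq> 2 * pi \<or> s \<noteq> 0" "u2 \<noteq> t"
          using ne per by auto
        then show "t < u2" "u2 < s + 2 * pi"
          using False far(2) st by auto
      qed simp
    qed
    have "s < u1" "u1 < t"
      using far(1) ne by (auto simp: le_less)
    then have "ennreal (pi / 48 * ln (R / (4 * \<epsilon>))) \<le> mnts K"
      using far u3 near by (intro mnts_ge_ln[of s u1 t u3 \<epsilon> R]) auto
    then show ?thesis
      by (rule min.coboundedI2)
  qed
qed

theorem theorem7p3p1: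
  fixes b \<delta> :: real
  assumes "0 < \<delta>" and "\<delta> \<le> 1 / 2"
  shows "\<exists>C>0. \<forall>f K. C2_embedding f \<and> K = f ` sphere 0 1 \<longrightarrow>
           (\<exists>s t. 0 \<le> s \<and> s \<le> t \<and> t \<le> 2 * pi \<and>
              shorter_arc_length f s t = \<delta> * knot_length f \<and>
              dist (f (cis s)) (f (cis t)) \<le> C * knot_length f) \<longrightarrow>
           ennreal b \<le> mnts K"
proof -
  \<comment> \<open>With \<open>L = \<delta> * l / 2\<close>, \<open>R = \<rho> * l\<close> and \<open>\<epsilon> = C * l\<close>, where \<open>l\<close> is the length of the knot, both lower
    bounds of \<open>mnts_ge_of_close_pair\<close> are equal to \<open>\<bar>b\<bar>\<close>.\<close>
  define \<rho> where "\<rho> = \<delta> / (16000 * (54 + 12 * \<bar>b\<bar> / pi))"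
  define C where "C = \<rho> / 4 * exp (- (48 * \<bar>b\<bar> / pi))"
  have pos: "54 + 12 * \<bar>b\<bar> / pi > 0"
    by (intro add_pos_nonneg) auto
  then have \<rho>: "\<rho> > 0"
    using assms by (simp add: \<rho>_def)
  then have C: "C > 0"
    by (simp add: C_def)
  have "4 * C \<le> \<rho>"
    using \<rho> by (simp add: C_def)
  have "\<delta> / 2 / (8000 * \<rho>) = 54 + 12 * \<bar>b\<bar> / pi"
    using assms pos by (simp add: \<rho>_def)
  then have bound1: "pi / 12 * (\<delta> / 2 / (8000 * \<rho>) - 54) = \<bar>b\<bar>"
    by simp
  have "\<rho> / (4 * C) = exp (48 * \<bar>b\<bar> / pi)"
    using \<rho> by (simp add: C_def exp_minus field_simps)
  then have bound2: "pi / 48 * ln (\<rho> / (4 * C)) = \<bar>b\<bar>"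
    by simp
  have "ennreal b \<le> mnts (f ` sphere 0 1)"
    if f: "C2_embedding f" and st: "0 \<le> s" "s \<le> t" "t \<le> 2 * pi"
      and arc: "shorter_arc_length f s t = \<delta> * knot_length f"
      and near: "dist (f (cis s)) (f (cis t)) \<le> C * knot_length f" for f s t
  proof -
    obtain f' f'' where f': "\<And>t. ((\<lambda>t. f (cis t)) has_vector_derivative f' t) (at t)"
      and f'': "\<And>t. (f' has_vector_derivative f'' t) (at t)" and f'_ne: "\<And>t. f' t \<noteq> 0"
      using f unfolding C2_embedding_def by blast
    interpret simple_closed_curve "\<lambda>t. f (cis t)" "f ` sphere 0 1"
      by (rule simple_closed_curve_of_embedding[OF f])
    have cont': "continuous_on UNIV f'"
      using f'' by (meson continuous_at_imp_continuous_on has_vector_derivative_continuous)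
    have al: "arc_length f u v = integral {u..v} (\<lambda>x. norm (f' x))" for u v
      unfolding arc_length_def vector_derivative_at[OF f'] ..
    have int: "(\<lambda>x. norm (f' x)) integrable_on {u..v}" for u v
      by (intro integrable_continuous_real continuous_intros continuous_on_subset[OF cont'] subset_UNIV)
    have "continuous_on {0..2 * pi} (\<lambda>x. norm (f' x))"
      by (intro continuous_intros continuous_on_subset[OF cont'] subset_UNIV)
    then have "knot_length f \<noteq> 0"
      unfolding knot_length_def al using f'_ne[of 0] by (subst integral_eq_0_iff) auto
    moreover have "knot_length f \<ge> 0"
      unfolding knot_length_def al by (intro integral_nonneg int) simp
    ultimately have l: "knot_length f > 0"
      by simp
    have "knot_length f = integral {0..s} (\<lambda>x. norm (f' x)) + integral {s..t} (\<lambda>x. norm (f' x))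
        + integral {t..2 * pi} (\<lambda>x. norm (f' x))"
      unfolding knot_length_def al using st int
      by (simp add: Henstock_Kurzweil_Integration.integral_combine)
    with arc have arcs: "\<delta> * knot_length f \<le> integral {s..t} (\<lambda>x. norm (f' x))"
      "\<delta> * knot_length f \<le> integral {0..s} (\<lambda>x. norm (f' x)) + integral {t..2 * pi} (\<lambda>x. norm (f' x))"
      unfolding shorter_arc_length_def al by auto
    have "4 * (C * knot_length f) \<le> \<rho> * knot_length f"
      using \<open>4 * C \<le> \<rho>\<close> l by simp
    then have "min (ennreal (pi / 12 * (\<delta> * knot_length f / 2 / (8000 * (\<rho> * knot_length f)) - 54)))
        (ennreal (pi / 48 * ln (\<rho> * knot_length f / (4 * (C * knot_length f))))) \<le> mnts (f ` sphere 0 1)"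
      using l C assms(1) arcs near st
      by (intro mnts_ge_of_close_pair[OF f' cont', of s t]) (auto intro: order_trans[rotated])
    also have "\<delta> * knot_length f / 2 / (8000 * (\<rho> * knot_length f)) = \<delta> / 2 / (8000 * \<rho>)"
      using l by simp
    also have "\<rho> * knot_length f / (4 * (C * knot_length f)) = \<rho> / (4 * C)"
      using l by simp
    finally have "ennreal \<bar>b\<bar> \<le> mnts (f ` sphere 0 1)"
      unfolding bound1 bound2 by simp
    then show ?thesis
      by (rule order_trans[rotated]) (simp add: ennreal_leI)
  qed
  then show ?thesis
    using C by (intro exI[of _ C]) blast
qed

end
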